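(* The map $\psi\mapsto\|\psi\|_{a\text{-flux}}:=\|(a\nabla\psi)_{pot}\|_{(L^2(\Omega))^d}$ is a norm on $H^1_0(\Omega)$. Furthermore, for all $\psi\in H^1_0(\Omega)$, $$\lambda_{\min}(a)\,\|\nabla\psi\|_{(L^2(\Omega))^d}\le\|\psi\|_{a\text{-flux}}\le\lambda_{\max}(a)\,\|\nabla\psi\|_{(L^2(\Omega))^d}.$$
   Context: $\Omega\subset\mathbb{R}^d$ ($d\ge 2$) is a bounded domain with $C^2$ boundary. The matrix $a=(a_{ij})$ has $a_{ij}\in L^\infty(\Omega)$, is symmetric, and is uniformly elliptic: $\lambda_{\min}(a)|\xi|^2\le\xi^Ta(x)\xi\le\lambda_{\max}(a)|\xi|^2$ for all $\xi\in\mathbb{R}^d$ and (almost) all $x\in\Omega$, with constants $0<\lambda_{\min}(a)\le\lambda_{\max}(a)<\infty$. For $k\in(L^2(\Omega))^d$, $k_{pot}$ is the $L^2$-orthogonal projection of $k$ onto the closure of $\{\nabla g: g\in C_0^\infty(\Omega)\}$ in $(L^2(\Omega))^d$. *)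

theory Defs
  imports "HOL-Analysis.Analysis"
begin

definition partial_deriv :: "'n \<Rightarrow> (real^'n \<Rightarrow> real) \<Rightarrow> real^'n \<Rightarrow> real" where
  "partial_deriv i f x = frechet_derivative f (at x) (axis i 1)"

definition gradient :: "(real^'n \<Rightarrow> real) \<Rightarrow> real^'n \<Rightarrow> real^'n" where
  "gradient f x = (\<chi> i. partial_deriv i f x)"

primrec Ck :: "nat \<Rightarrow> (real^'n \<Rightarrow> real) \<Rightarrow> bool" where
  "Ck 0 f \<longleftrightarrow> continuous_on UNIV f"
| "Ck (Suc k) f \<longleftrightarrow> (\<forall>x. f differentiable (at x)) \<and> (\<forall>i. Ck k (partial_deriv i f))"

text \<open>\<open>C\<^sub>0\<^sup>\<infinity>(\<Omega>)\<close>: smooth functions with compact support contained in \<open>\<Omega>\<close>, each extended by zero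
  to the whole space.\<close>

definition test_functions :: "(real^'n) set \<Rightarrow> (real^'n \<Rightarrow> real) set" where
  "test_functions \<Omega> =
     {f. (\<forall>k. Ck k f) \<and> compact (closure {x. f x \<noteq> 0}) \<and> closure {x. f x \<noteq> 0} \<subseteq> \<Omega>}"

text \<open>Near each boundary point, \<open>\<Omega>\<close> is the region on one side of the graph of a \<open>C\<^sup>2\<close> function of
  the remaining \<open>d - 1\<close> coordinates, up to relabelling (\<open>i\<close>) and reorienting (\<open>s\<close>) the axes.
  A function of the coordinates other than the \<open>i\<close>-th is encoded as a function on the whole space
  that is constant in direction \<open>i\<close>.\<close>

definition C2_boundary :: "(real^'n) set \<Rightarrow> bool" where
  "C2_boundary \<Omega> \<longleftrightarrow>
     (\<forall>x0 \<in> frontier \<Omega>. \<exists>r>0. \<exists>i. \<exists>s\<in>{1, -1}. \<exists>\<gamma>.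
        Ck 2 \<gamma> \<and> (\<forall>x t. \<gamma> (x + t *\<^sub>R axis i 1) = \<gamma> x) \<and>
        \<Omega> \<inter> ball x0 r = {x \<in> ball x0 r. \<gamma> x < s * x $ i})"

definition bounded_C2_domain :: "(real^'n) set \<Rightarrow> bool" where
  "bounded_C2_domain \<Omega> \<longleftrightarrow>
     \<Omega> \<noteq> {} \<and> open \<Omega> \<and> connected \<Omega> \<and> bounded \<Omega> \<and> C2_boundary \<Omega>"

text \<open>Elements of \<open>L\<^sup>2\<close>, \<open>L\<^sup>\<infinity>\<close> and the Sobolev spaces are represented by functions; two functions
  represent the same element iff they agree almost everywhere on \<open>\<Omega>\<close>. Values outside \<open>\<Omega>\<close> are
  irrelevant.\<close>

definition L2 :: "(real^'n) set \<Rightarrow> (real^'n \<Rightarrow> 'b::euclidean_space) set" where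
  "L2 \<Omega> = {f \<in> borel_measurable (lebesgue_on \<Omega>). integrable (lebesgue_on \<Omega>) (\<lambda>x. (norm (f x))\<^sup>2)}"

definition L2_inner ::
  "(real^'n) set \<Rightarrow> (real^'n \<Rightarrow> 'b::euclidean_space) \<Rightarrow> (real^'n \<Rightarrow> 'b) \<Rightarrow> real" where
  "L2_inner \<Omega> f g = (\<integral>x. f x \<bullet> g x \<partial>lebesgue_on \<Omega>)"

definition L2_norm :: "(real^'n) set \<Rightarrow> (real^'n \<Rightarrow> 'b::euclidean_space) \<Rightarrow> real" where
  "L2_norm \<Omega> f = sqrt (\<integral>x. (norm (f x))\<^sup>2 \<partial>lebesgue_on \<Omega>)"

definition Linf :: "(real^'n) set \<Rightarrow> (real^'n \<Rightarrow> real) set" where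
  "Linf \<Omega> = {f \<in> borel_measurable (lebesgue_on \<Omega>). \<exists>C. AE x in lebesgue_on \<Omega>. \<bar>f x\<bar> \<le> C}"

definition L2_closure ::
  "(real^'n) set \<Rightarrow> (real^'n \<Rightarrow> 'b::euclidean_space) set \<Rightarrow> (real^'n \<Rightarrow> 'b) set" where
  "L2_closure \<Omega> A =
     {k \<in> L2 \<Omega>. \<exists>u::nat \<Rightarrow> _. (\<forall>n. u n \<in> A) \<and> (\<lambda>n. L2_norm \<Omega> (\<lambda>x. u n x - k x)) \<longlonglongrightarrow> 0}"

definition is_weak_gradient ::
  "(real^'n) set \<Rightarrow> (real^'n \<Rightarrow> real) \<Rightarrow> (real^'n \<Rightarrow> real^'n) \<Rightarrow> bool" where
  "is_weak_gradient \<Omega> \<psi> G \<longleftrightarrow>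
     (\<forall>\<phi> \<in> test_functions \<Omega>. \<forall>i.
        (\<integral>x. \<psi> x * partial_deriv i \<phi> x \<partial>lebesgue_on \<Omega>)
          = - (\<integral>x. G x $ i * \<phi> x \<partial>lebesgue_on \<Omega>))"

definition H1 :: "(real^'n) set \<Rightarrow> (real^'n \<Rightarrow> real) set" where
  "H1 \<Omega> = {\<psi> \<in> L2 \<Omega>. \<exists>G \<in> L2 \<Omega>. is_weak_gradient \<Omega> \<psi> G}"

text \<open>For open \<open>\<Omega>\<close> and \<open>\<psi> \<in> H1 \<Omega>\<close> the weak gradient is unique up to null sets; the choice operator
  picks a representative.\<close>

definition weak_gradient :: "(real^'n) set \<Rightarrow> (real^'n \<Rightarrow> real) \<Rightarrow> real^'n \<Rightarrow> real^'n" where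
  "weak_gradient \<Omega> \<psi> = (SOME G. G \<in> L2 \<Omega> \<and> is_weak_gradient \<Omega> \<psi> G)"

definition H1_norm :: "(real^'n) set \<Rightarrow> (real^'n \<Rightarrow> real) \<Rightarrow> real" where
  "H1_norm \<Omega> \<psi> = sqrt ((L2_norm \<Omega> \<psi>)\<^sup>2 + (L2_norm \<Omega> (weak_gradient \<Omega> \<psi>))\<^sup>2)"

definition H10 :: "(real^'n) set \<Rightarrow> (real^'n \<Rightarrow> real) set" where
  "H10 \<Omega> =
     {\<psi> \<in> H1 \<Omega>. \<exists>\<phi>::nat \<Rightarrow> _. (\<forall>n. \<phi> n \<in> test_functions \<Omega>) \<and>
        (\<lambda>n. H1_norm \<Omega> (\<lambda>x. \<phi> n x - \<psi> x)) \<longlonglongrightarrow> 0}"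

definition potential_fields :: "(real^'n) set \<Rightarrow> (real^'n \<Rightarrow> real^'n) set" where
  "potential_fields \<Omega> = L2_closure \<Omega> (gradient ` test_functions \<Omega>)"

definition is_L2_projection ::
  "(real^'n) set \<Rightarrow> (real^'n \<Rightarrow> 'b::euclidean_space) set \<Rightarrow> (real^'n \<Rightarrow> 'b) \<Rightarrow> (real^'n \<Rightarrow> 'b) \<Rightarrow> bool"
  where
  "is_L2_projection \<Omega> V k p \<longleftrightarrow>
     p \<in> V \<and> (\<forall>v \<in> V. L2_inner \<Omega> (\<lambda>x. k x - p x) v = 0)"

text \<open>The projection of \<open>k \<in> L2 \<Omega>\<close> exists and is unique up to null sets; the choice operator picks
  a representative.\<close>

definition pot :: "(real^'n) set \<Rightarrow> (real^'n \<Rightarrow> real^'n) \<Rightarrow> real^'n \<Rightarrow> real^'n" where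
  "pot \<Omega> k = (SOME p. is_L2_projection \<Omega> (potential_fields \<Omega>) k p)"

definition flux_norm ::
  "(real^'n) set \<Rightarrow> (real^'n \<Rightarrow> real^'n^'n) \<Rightarrow> (real^'n \<Rightarrow> real) \<Rightarrow> real" where
  "flux_norm \<Omega> a \<psi> = L2_norm \<Omega> (pot \<Omega> (\<lambda>x. a x *v weak_gradient \<Omega> \<psi> x))"

text \<open>\<open>V\<close> is a vector space of functions and \<open>N\<close> induces a norm on the quotient of \<open>V\<close> by equality
  almost everywhere; the first condition on \<open>N\<close> is well-definedness on the quotient.\<close>

definition is_norm_on_AE ::
  "'a measure \<Rightarrow> ('a \<Rightarrow> real) set \<Rightarrow> (('a \<Rightarrow> real) \<Rightarrow> real) \<Rightarrow> bool" where
  "is_norm_on_AE M V N \<longleftrightarrow>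
     (\<lambda>x. 0) \<in> V \<and>
     (\<forall>f\<in>V. \<forall>g\<in>V. (\<lambda>x. f x + g x) \<in> V) \<and>
     (\<forall>c. \<forall>f\<in>V. (\<lambda>x. c * f x) \<in> V) \<and>
     (\<forall>f\<in>V. \<forall>g\<in>V. (AE x in M. f x = g x) \<longrightarrow> N f = N g) \<and>
     (\<forall>f\<in>V. 0 \<le> N f) \<and>
     (\<forall>f\<in>V. N f = 0 \<longleftrightarrow> (AE x in M. f x = 0)) \<and>
     (\<forall>c. \<forall>f\<in>V. N (\<lambda>x. c * f x) = \<bar>c\<bar> * N f) \<and>
     (\<forall>f\<in>V. \<forall>g\<in>V. N (\<lambda>x. f x + g x) \<le> N f + N g)"

definition elliptic_coefficients ::
  "(real^'n) set \<Rightarrow> (real^'n \<Rightarrow> real^'n^'n) \<Rightarrow> real \<Rightarrow> real \<Rightarrow> bool" where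
  "elliptic_coefficients \<Omega> a lmin lmax \<longleftrightarrow>
     (\<forall>i j. (\<lambda>x. a x $ i $ j) \<in> Linf \<Omega>) \<and>
     (AE x in lebesgue_on \<Omega>. transpose (a x) = a x) \<and>
     0 < lmin \<and> lmin \<le> lmax \<and>
     (AE x in lebesgue_on \<Omega>. \<forall>\<xi>.
        lmin * (norm \<xi>)\<^sup>2 \<le> \<xi> \<bullet> (a x *v \<xi>) \<and> \<xi> \<bullet> (a x *v \<xi>) \<le> lmax * (norm \<xi>)\<^sup>2)"

end

theory Submission
  imports Defs
begin

text \<open>Let \<open>P\<close> be the projection onto potential fields, \<open>G = \<nabla>\<psi>\<close> and \<open>p = P(aG)\<close>. Since \<open>G\<close> is
  itself a potential field, \<open>\<langle>p, G\<rangle> = \<langle>aG, G\<rangle> \<ge> \<lambda>\<^sub>m\<^sub>i\<^sub>n |G|\<^sup>2\<close>, which gives the lower bound by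
  Cauchy--Schwarz; the upper bound is \<open>|p| \<le> |aG|\<close> and the operator norm bound \<open>\<lambda>\<^sub>m\<^sub>a\<^sub>x\<close> for the
  symmetric matrix \<open>a\<close>. Definiteness follows from the lower bound and the Poincare inequality on the
  bounded set \<open>\<Omega>\<close>; the remaining norm axioms follow from linearity of \<open>\<psi> \<mapsto> \<nabla>\<psi>\<close> and of \<open>P\<close> up to
  null sets. Existence of \<open>P\<close> rests on completeness of \<open>L\<^sup>2\<close>, and uniqueness of the weak gradient on
  smooth approximations of indicators of boxes.\<close>

section \<open>The Hilbert space \<open>L\<^sup>2\<close>\<close>

text \<open>Every object here is a function, not a class modulo null sets, and both
  \<open>weak_gradient\<close> and \<open>pot\<close> are values of a choice operator. Neither is
  literally linear, so identities between chosen representatives hold only almost everywhere. The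
  proof therefore works with the predicates \<open>is_weak_gradient\<close> and
  \<open>is_L2_projection\<close>, which are literally stable under sums and multiples, and comes
  back to the chosen representatives through uniqueness: \<open>flux_norm_eqI\<close> computes the
  flux norm from any weak gradient and any projection. \<open>H1_norm\<close> also contains a chosen
  gradient, so even closure of \<open>H10\<close> under addition rests on uniqueness of weak
  gradients, hence on the fundamental lemma.

  Test functions are extended by zero, so integrals of their products over \<Omega> become integrals
  over the whole space. There translation invariance is available, and integration by parts has no
  boundary term.

  The upper constant is sharp in \<open>lmax\<close> because for a symmetric positive matrix a bound
  on the quadratic form is also a bound on the operator norm.\<close>

lemma L2_measurable: "f \<in> L2 \<Omega> \<Longrightarrow> f \<in> borel_measurable (lebesgue_on \<Omega>)"
  by (simp add: L2_def)

lemma L2_integrable: "f \<in> L2 \<Omega> \<Longrightarrow> integrable (lebesgue_on \<Omega>) (\<lambda>x. (norm (f x))\<^sup>2)"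
  by (simp add: L2_def)

lemma L2_dominated:
  assumes "f \<in> borel_measurable (lebesgue_on \<Omega>)" "g \<in> L2 \<Omega>"
    and "AE x in lebesgue_on \<Omega>. norm (f x) \<le> c * norm (g x)"
  shows "f \<in> L2 \<Omega>"
proof -
  have "integrable (lebesgue_on \<Omega>) (\<lambda>x. (norm (f x))\<^sup>2)"
  proof (rule Bochner_Integration.integrable_bound)
    show "integrable (lebesgue_on \<Omega>) (\<lambda>x. c\<^sup>2 * (norm (g x))\<^sup>2)"
      using L2_integrable[OF assms(2)] by simp
    show "AE x in lebesgue_on \<Omega>. norm ((norm (f x))\<^sup>2) \<le> norm (c\<^sup>2 * (norm (g x))\<^sup>2)"
      using assms(3)
    proof eventually_elim
      case (elim x)
      then have "(norm (f x))\<^sup>2 \<le> (c * norm (g x))\<^sup>2" by (intro power_mono) auto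
      then show ?case by (simp add: power_mult_distrib)
    qed
  qed (use assms(1) in measurable)
  with assms(1) show ?thesis by (simp add: L2_def)
qed

lemma L2_inner_integrable:
  assumes "f \<in> L2 \<Omega>" "g \<in> L2 \<Omega>"
  shows "integrable (lebesgue_on \<Omega>) (\<lambda>x. f x \<bullet> g x)"
proof (rule Bochner_Integration.integrable_bound)
  show "integrable (lebesgue_on \<Omega>) (\<lambda>x. (norm (f x))\<^sup>2 + (norm (g x))\<^sup>2)"
    using assms by (simp add: L2_integrable)
  show "(\<lambda>x. f x \<bullet> g x) \<in> borel_measurable (lebesgue_on \<Omega>)"
    using assms[THEN L2_measurable] by measurable
  show "AE x in lebesgue_on \<Omega>. norm (f x \<bullet> g x) \<le> norm ((norm (f x))\<^sup>2 + (norm (g x))\<^sup>2)"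
  proof (rule AE_I2)
    fix x
    have "\<bar>f x \<bullet> g x\<bar> \<le> norm (f x) * norm (g x)" by (rule Cauchy_Schwarz_ineq2)
    also have "\<dots> \<le> 2 * norm (f x) * norm (g x)" by simp
    also have "\<dots> \<le> (norm (f x))\<^sup>2 + (norm (g x))\<^sup>2" by (rule sum_squares_bound)
    finally show "norm (f x \<bullet> g x) \<le> norm ((norm (f x))\<^sup>2 + (norm (g x))\<^sup>2)" by simp
  qed
qed

lemma L2_zero: "(\<lambda>x. 0) \<in> L2 \<Omega>"
  by (simp add: L2_def)

lemma L2_scale: "f \<in> L2 \<Omega> \<Longrightarrow> (\<lambda>x. c *\<^sub>R f x) \<in> L2 \<Omega>"
  by (rule L2_dominated[where g = f and c = "\<bar>c\<bar>"])
    (auto dest: L2_measurable intro!: borel_measurable_scaleR)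

lemma L2_add:
  assumes "f \<in> L2 \<Omega>" "g \<in> L2 \<Omega>"
  shows "(\<lambda>x. f x + g x) \<in> L2 \<Omega>"
proof -
  have "integrable (lebesgue_on \<Omega>) (\<lambda>x. (norm (f x))\<^sup>2 + (norm (g x))\<^sup>2 + 2 * (f x \<bullet> g x))"
    using assms by (intro Bochner_Integration.integrable_add integrable_mult_right
        L2_inner_integrable L2_integrable)
  then have "integrable (lebesgue_on \<Omega>) (\<lambda>x. (norm (f x + g x))\<^sup>2)"
    by (simp add: power2_norm_eq_inner algebra_simps inner_commute)
  with assms[THEN L2_measurable] show ?thesis by (simp add: L2_def)
qed

lemma L2_diff:
  assumes "f \<in> L2 \<Omega>" "g \<in> L2 \<Omega>"
  shows "(\<lambda>x. f x - g x) \<in> L2 \<Omega>"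
  using L2_add[OF assms(1) L2_scale[OF assms(2), of "-1"]] by simp

lemma L2_inner_commute: "L2_inner \<Omega> f g = L2_inner \<Omega> g f"
  by (simp add: L2_inner_def inner_commute)

lemma L2_inner_add_left:
  assumes "f \<in> L2 \<Omega>" "g \<in> L2 \<Omega>" "h \<in> L2 \<Omega>"
  shows "L2_inner \<Omega> (\<lambda>x. f x + g x) h = L2_inner \<Omega> f h + L2_inner \<Omega> g h"
  using assms by (simp add: L2_inner_def inner_add_left L2_inner_integrable)

lemma L2_inner_diff_left:
  assumes "f \<in> L2 \<Omega>" "g \<in> L2 \<Omega>" "h \<in> L2 \<Omega>"
  shows "L2_inner \<Omega> (\<lambda>x. f x - g x) h = L2_inner \<Omega> f h - L2_inner \<Omega> g h"
  using assms by (simp add: L2_inner_def inner_diff_left L2_inner_integrable)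

lemma L2_inner_scale_left: "L2_inner \<Omega> (\<lambda>x. c *\<^sub>R f x) h = c * L2_inner \<Omega> f h"
  by (simp add: L2_inner_def)

lemma L2_inner_add_right:
  assumes "f \<in> L2 \<Omega>" "g \<in> L2 \<Omega>" "h \<in> L2 \<Omega>"
  shows "L2_inner \<Omega> h (\<lambda>x. f x + g x) = L2_inner \<Omega> h f + L2_inner \<Omega> h g"
  using L2_inner_add_left[OF assms] by (simp only: L2_inner_commute[of \<Omega> h])

lemma L2_inner_diff_right:
  assumes "f \<in> L2 \<Omega>" "g \<in> L2 \<Omega>" "h \<in> L2 \<Omega>"
  shows "L2_inner \<Omega> h (\<lambda>x. f x - g x) = L2_inner \<Omega> h f - L2_inner \<Omega> h g"
  using L2_inner_diff_left[OF assms] by (simp only: L2_inner_commute[of \<Omega> h])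

lemma L2_inner_scale_right: "L2_inner \<Omega> h (\<lambda>x. c *\<^sub>R f x) = c * L2_inner \<Omega> h f"
  by (simp add: L2_inner_def)

lemma L2_inner_cong_AE:
  assumes "f \<in> L2 \<Omega>" "f' \<in> L2 \<Omega>" "h \<in> L2 \<Omega>" "AE x in lebesgue_on \<Omega>. f x = f' x"
  shows "L2_inner \<Omega> f h = L2_inner \<Omega> f' h"
  unfolding L2_inner_def
proof (rule integral_cong_AE)
  show "AE x in lebesgue_on \<Omega>. f x \<bullet> h x = f' x \<bullet> h x"
    using assms(4) by eventually_elim simp
qed (use assms(1-3)[THEN L2_measurable] in measurable)

section \<open>The \<open>L2\<close> seminorm: null sets, Cauchy-Schwarz, triangle inequality,
  parallelogram law\<close>

lemma L2_norm_power2: "(L2_norm \<Omega> f)\<^sup>2 = L2_inner \<Omega> f f"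
  by (simp add: L2_norm_def L2_inner_def power2_norm_eq_inner)

lemma L2_norm_nonneg [simp]: "0 \<le> L2_norm \<Omega> f"
  by (simp add: L2_norm_def)

lemma L2_norm_zero [simp]: "L2_norm \<Omega> (\<lambda>x. 0) = 0"
  by (simp add: L2_norm_def)

lemma L2_norm_scale: "L2_norm \<Omega> (\<lambda>x. c *\<^sub>R f x) = \<bar>c\<bar> * L2_norm \<Omega> f"
  by (simp add: L2_norm_def power_mult_distrib real_sqrt_mult)

lemma L2_norm_minus_commute: "L2_norm \<Omega> (\<lambda>x. f x - g x) = L2_norm \<Omega> (\<lambda>x. g x - f x)"
  by (simp add: L2_norm_def norm_minus_commute)

lemma L2_norm_cong_AE:
  assumes "f \<in> L2 \<Omega>" "g \<in> L2 \<Omega>" "AE x in lebesgue_on \<Omega>. f x = g x"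
  shows "L2_norm \<Omega> f = L2_norm \<Omega> g"
proof -
  have "(\<integral>x. (norm (f x))\<^sup>2 \<partial>lebesgue_on \<Omega>) = (\<integral>x. (norm (g x))\<^sup>2 \<partial>lebesgue_on \<Omega>)"
  proof (rule integral_cong_AE)
    show "AE x in lebesgue_on \<Omega>. (norm (f x))\<^sup>2 = (norm (g x))\<^sup>2"
      using assms(3) by eventually_elim simp
  qed (use assms(1,2)[THEN L2_measurable] in measurable)
  then show ?thesis by (simp add: L2_norm_def)
qed

lemma L2_norm_eq_0_iff:
  assumes "f \<in> L2 \<Omega>"
  shows "L2_norm \<Omega> f = 0 \<longleftrightarrow> (AE x in lebesgue_on \<Omega>. f x = 0)"
  using integral_nonneg_eq_0_iff_AE[OF L2_integrable[OF assms]] by (simp add: L2_norm_def)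

lemma L2_norm_mono_AE:
  assumes "f \<in> L2 \<Omega>" "g \<in> L2 \<Omega>" "0 \<le> c" "AE x in lebesgue_on \<Omega>. norm (f x) \<le> c * norm (g x)"
  shows "L2_norm \<Omega> f \<le> c * L2_norm \<Omega> g"
proof -
  have "(\<integral>x. (norm (f x))\<^sup>2 \<partial>lebesgue_on \<Omega>) \<le> (\<integral>x. c\<^sup>2 * (norm (g x))\<^sup>2 \<partial>lebesgue_on \<Omega>)"
  proof (rule integral_mono_AE)
    show "AE x in lebesgue_on \<Omega>. (norm (f x))\<^sup>2 \<le> c\<^sup>2 * (norm (g x))\<^sup>2"
      using assms(4)
    proof eventually_elim
      case (elim x)
      then have "(norm (f x))\<^sup>2 \<le> (c * norm (g x))\<^sup>2" by (intro power_mono) auto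
      then show ?case by (simp add: power_mult_distrib)
    qed
  qed (use assms L2_integrable in auto)
  then have "L2_norm \<Omega> f \<le> sqrt (c\<^sup>2 * (\<integral>x. (norm (g x))\<^sup>2 \<partial>lebesgue_on \<Omega>))"
    by (simp add: L2_norm_def)
  then show ?thesis using assms(3) by (simp add: L2_norm_def real_sqrt_mult)
qed

text \<open>On functions \<open>L2_inner\<close> is only positive semidefinite. The argument uses
  nonnegativity of the binary quadratic form of \<open>s f + t g\<close> and treats the degenerate
  case \<open>?C = 0\<close> apart.\<close>

lemma L2_Cauchy_Schwarz:
  assumes "f \<in> L2 \<Omega>" "g \<in> L2 \<Omega>"
  shows "\<bar>L2_inner \<Omega> f g\<bar> \<le> L2_norm \<Omega> f * L2_norm \<Omega> g"
proof -
  let ?A = "L2_inner \<Omega> f f" and ?B = "L2_inner \<Omega> f g" and ?C = "L2_inner \<Omega> g g"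
  have quad: "0 \<le> ?A * s\<^sup>2 + 2 * ?B * s * t + ?C * t\<^sup>2" for s t
  proof -
    have "0 \<le> L2_inner \<Omega> (\<lambda>x. s *\<^sub>R f x + t *\<^sub>R g x) (\<lambda>x. s *\<^sub>R f x + t *\<^sub>R g x)"
      by (simp flip: L2_norm_power2)
    also have "\<dots> = ?A * s\<^sup>2 + 2 * ?B * s * t + ?C * t\<^sup>2"
      using assms
      by (simp add: L2_inner_add_left L2_inner_add_right L2_add L2_scale L2_inner_scale_left
          L2_inner_scale_right L2_inner_commute[of \<Omega> g f] algebra_simps power2_eq_square)
    finally show ?thesis .
  qed
  have A: "0 \<le> ?A" and C: "0 \<le> ?C" by (simp_all flip: L2_norm_power2)
  have "?B\<^sup>2 \<le> ?A * ?C"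
  proof (cases "?C = 0")
    case True
    have "?B = 0"
    proof (rule ccontr)
      assume "?B \<noteq> 0"
      \<comment> \<open>For \<open>?C = 0\<close> and \<open>s = 1\<close> the form is affine in
        \<open>t\<close>; this \<open>t\<close> gives it the value -1.\<close>
      moreover have "0 \<le> ?A + 2 * ?B * (- (?A + 1) / (2 * ?B))"
        using quad[of 1 "- (?A + 1) / (2 * ?B)"] True by simp
      ultimately show False by (simp add: field_simps)
    qed
    with True show ?thesis by simp
  next
    case False
    with C have C': "0 < ?C" by simp
    \<comment> \<open>The choice \<open>s = ?C\<close>, \<open>t = - ?B\<close> makes
      \<open>?C\<close> a common factor of the form.\<close>
    have "0 \<le> ?C * (?A * ?C - ?B\<^sup>2)"
      using quad[of ?C "- ?B"] by (simp add: algebra_simps power2_eq_square)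
    with C' show ?thesis by (simp add: zero_le_mult_iff)
  qed
  then have "\<bar>?B\<bar>\<^sup>2 \<le> (L2_norm \<Omega> f * L2_norm \<Omega> g)\<^sup>2"
    by (simp add: power_mult_distrib L2_norm_power2)
  then show ?thesis by (rule power2_le_imp_le) simp
qed

lemma L2_norm_triangle:
  assumes "f \<in> L2 \<Omega>" "g \<in> L2 \<Omega>"
  shows "L2_norm \<Omega> (\<lambda>x. f x + g x) \<le> L2_norm \<Omega> f + L2_norm \<Omega> g"
proof -
  have "(L2_norm \<Omega> (\<lambda>x. f x + g x))\<^sup>2 = (L2_norm \<Omega> f)\<^sup>2 + 2 * L2_inner \<Omega> f g + (L2_norm \<Omega> g)\<^sup>2"
    using assms
    by (simp add: L2_norm_power2 L2_inner_add_left L2_inner_add_right L2_add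
        L2_inner_commute[of \<Omega> g f])
  also have "\<dots> \<le> (L2_norm \<Omega> f + L2_norm \<Omega> g)\<^sup>2"
    using L2_Cauchy_Schwarz[OF assms] by (simp add: power2_sum)
  finally show ?thesis by (rule power2_le_imp_le) simp
qed

lemma L2_norm_triangle_diff:
  assumes "f \<in> L2 \<Omega>" "g \<in> L2 \<Omega>" "h \<in> L2 \<Omega>"
  shows "L2_norm \<Omega> (\<lambda>x. f x - h x) \<le> L2_norm \<Omega> (\<lambda>x. f x - g x) + L2_norm \<Omega> (\<lambda>x. g x - h x)"
  using L2_norm_triangle[OF L2_diff[OF assms(1,2)] L2_diff[OF assms(2,3)]] by simp

lemma L2_parallelogram:
  assumes "f \<in> L2 \<Omega>" "g \<in> L2 \<Omega>"
  shows "(L2_norm \<Omega> (\<lambda>x. f x - g x))\<^sup>2 + (L2_norm \<Omega> (\<lambda>x. f x + g x))\<^sup>2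
    = 2 * (L2_norm \<Omega> f)\<^sup>2 + 2 * (L2_norm \<Omega> g)\<^sup>2"
  using assms
  by (simp add: L2_norm_power2 L2_inner_add_left L2_inner_add_right L2_inner_diff_left
      L2_inner_diff_right L2_add L2_diff)

lemma nn_integral_norm_power2:
  assumes "f \<in> L2 \<Omega>"
  shows "(\<integral>\<^sup>+x. ennreal ((norm (f x))\<^sup>2) \<partial>lebesgue_on \<Omega>) = ennreal ((L2_norm \<Omega> f)\<^sup>2)"
  using nn_integral_eq_integral[OF L2_integrable[OF assms]] by (simp add: L2_norm_def)

text \<open>Riesz--Fischer. The subsequence has steps of norm at most \<open>2\<^sup>-\<^sup>k\<close>; since
  \<open>2 |d| \<le> 2\<^sup>-\<^sup>k + 2\<^sup>k |d|\<^sup>2\<close>, integrating \<open>\<Sum>k. 2\<^sup>k |d\<^sub>k|\<^sup>2\<close> gives convergence almost everywhere,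
  whatever the measure of \<open>\<Omega>\<close>.\<close>

lemma L2_complete:
  fixes u :: "nat \<Rightarrow> real^'n \<Rightarrow> 'b::euclidean_space"
  assumes u: "\<And>n. u n \<in> L2 \<Omega>"
    and Cauchy: "\<And>e. 0 < e \<Longrightarrow> \<exists>N. \<forall>m\<ge>N. \<forall>n\<ge>N. L2_norm \<Omega> (\<lambda>x. u m x - u n x) < e"
  shows "\<exists>p\<in>L2 \<Omega>. (\<lambda>n. L2_norm \<Omega> (\<lambda>x. u n x - p x)) \<longlonglongrightarrow> 0"
proof -
  have um[measurable]: "u n \<in> borel_measurable (lebesgue_on \<Omega>)" for n
    using u L2_measurable by blast
  have "\<exists>N. \<forall>m\<ge>N. \<forall>n\<ge>N. L2_norm \<Omega> (\<lambda>x. u m x - u n x) < (1/2)^k" for k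
    by (rule Cauchy) simp
  then obtain N where N: "\<And>k m n. m \<ge> N k \<Longrightarrow> n \<ge> N k \<Longrightarrow> L2_norm \<Omega> (\<lambda>x. u m x - u n x) < (1/2)^k"
    by metis
  \<comment> \<open>Summing the \<open>N j\<close> makes \<open>r\<close> monotone and at least
    \<open>N k\<close> at once. The summand \<open>k\<close> forces \<open>k \<le> r k\<close>,
    which later pushes the subsequence past any index \<open>K\<close>.\<close>
  define r where "r k = k + sum N {..k}" for k
  have rN: "N k \<le> r k" for k unfolding r_def by (rule trans_le_add2, rule member_le_sum) auto
  have rge: "k \<le> r k" for k by (simp add: r_def)
  have rS: "r k \<le> r (Suc k)" for k by (simp add: r_def)
  have rN': "N k \<le> r j" if "k \<le> j" for j k
    using lift_Suc_mono_le[of r, OF rS that] rN[of k] by linarith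
  define d where "d k x = u (r (Suc k)) x - u (r k) x" for k x
  have dL: "d k \<in> L2 \<Omega>" for k unfolding d_def by (intro L2_diff u)
  have dm[measurable]: "d k \<in> borel_measurable (lebesgue_on \<Omega>)" for k
    using dL L2_measurable by blast
  have dn: "L2_norm \<Omega> (d k) \<le> (1/2)^k" for k
    unfolding d_def using N[of k "r (Suc k)" "r k"] rN'[of k] rN[of k] by (simp add: less_imp_le)
  have "(\<integral>\<^sup>+x. (\<Sum>k. ennreal (2^k * (norm (d k x))\<^sup>2)) \<partial>lebesgue_on \<Omega>)
      = (\<Sum>k. \<integral>\<^sup>+x. ennreal (2^k * (norm (d k x))\<^sup>2) \<partial>lebesgue_on \<Omega>)"
    by (rule nn_integral_suminf) measurable
  also have "\<dots> \<le> (\<Sum>k. ennreal ((1/2)^k))"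
  proof (rule suminf_le)
    fix k
    have "(\<integral>\<^sup>+x. ennreal (2^k * (norm (d k x))\<^sup>2) \<partial>lebesgue_on \<Omega>)
        = ennreal (2^k) * (\<integral>\<^sup>+x. ennreal ((norm (d k x))\<^sup>2) \<partial>lebesgue_on \<Omega>)"
      by (subst nn_integral_cmult[symmetric]) (auto simp: ennreal_mult)
    also have "\<dots> = ennreal (2^k * (L2_norm \<Omega> (d k))\<^sup>2)"
      by (simp add: nn_integral_norm_power2[OF dL] ennreal_mult)
    also have "\<dots> \<le> ennreal (2^k * ((1/2)^k)\<^sup>2)"
      by (intro ennreal_leI mult_left_mono power_mono dn) auto
    also have "2^k * ((1/2)^k)\<^sup>2 = ((1/2)^k :: real)"
      by (simp add: power_divide power2_eq_square)
    finally show "(\<integral>\<^sup>+x. ennreal (2^k * (norm (d k x))\<^sup>2) \<partial>lebesgue_on \<Omega>) \<le> ennreal ((1/2)^k)" .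
  qed auto
  also have "\<dots> = ennreal (\<Sum>k. (1/2)^k)"
    by (rule suminf_ennreal2) (auto intro: summable_geometric)
  finally have "(\<integral>\<^sup>+x. (\<Sum>k. ennreal (2^k * (norm (d k x))\<^sup>2)) \<partial>lebesgue_on \<Omega>) \<noteq> \<infinity>"
    by (auto simp: top_unique)
  then have "AE x in lebesgue_on \<Omega>. (\<Sum>k. ennreal (2^k * (norm (d k x))\<^sup>2)) \<noteq> \<infinity>"
    by (intro nn_integral_PInf_AE) measurable
  then have conv: "AE x in lebesgue_on \<Omega>. convergent (\<lambda>k. u (r k) x)"
  proof eventually_elim
    case (elim x)
    then have s: "summable (\<lambda>k. 2^k * (norm (d k x))\<^sup>2)"
      by (intro summable_suminf_not_top) auto
    have "summable (\<lambda>k. norm (d k x))"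
    proof (rule summable_comparison_test')
      show "summable (\<lambda>k. (1/2)^k + 2^k * (norm (d k x))\<^sup>2)"
        using s by (intro summable_add summable_geometric) auto
      fix k :: nat assume "0 \<le> k"
      have "0 \<le> 2^k * ((1/2)^k - norm (d k x))\<^sup>2" by simp
      also have "\<dots> = (1/2)^k + 2^k * (norm (d k x))\<^sup>2 - 2 * norm (d k x)"
        by (simp add: power2_eq_square algebra_simps power_divide)
      finally show "norm (norm (d k x)) \<le> (1/2)^k + 2^k * (norm (d k x))\<^sup>2"
        using norm_ge_zero[of "d k x"] unfolding real_norm_def abs_norm_cancel by linarith
    qed
    then have "summable (\<lambda>k. d k x)" by (rule summable_norm_cancel)
    then have "(\<lambda>n. \<Sum>k<n. d k x) \<longlonglongrightarrow> (\<Sum>k. d k x)" by (rule summable_LIMSEQ)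
    then have "(\<lambda>n. u (r n) x - u (r 0) x) \<longlonglongrightarrow> (\<Sum>k. d k x)"
      unfolding d_def by (subst (asm) sum_lessThan_telescope)
    then have "(\<lambda>n. (u (r n) x - u (r 0) x) + u (r 0) x) \<longlonglongrightarrow> (\<Sum>k. d k x) + u (r 0) x"
      by (intro tendsto_intros)
    then show ?case by (auto simp: convergent_def)
  qed
  \<comment> \<open>Where the subsequence diverges \<open>lim\<close> returns an arbitrary value;
    \<open>p\<close> is measurable nevertheless, and those points form a null set.\<close>
  define p where "p x = lim (\<lambda>k. u (r k) x)" for x
  have pm[measurable]: "p \<in> borel_measurable (lebesgue_on \<Omega>)"
    unfolding p_def by (rule borel_measurable_lim_metric) measurable
  \<comment> \<open>Fatou's lemma along the subsequence controls every late member of the whole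
    sequence. Nonnegative integrals are used because \<open>p\<close> is not yet known to be square
    integrable; that is deduced from this bound.\<close>
  have bound: "(\<integral>\<^sup>+x. ennreal ((norm (u m x - p x))\<^sup>2) \<partial>lebesgue_on \<Omega>) \<le> ennreal (e\<^sup>2)"
    if m: "\<forall>n\<ge>K. L2_norm \<Omega> (\<lambda>x. u m x - u n x) < e" and "0 < e" for m K e
  proof -
    have "(\<integral>\<^sup>+x. ennreal ((norm (u m x - p x))\<^sup>2) \<partial>lebesgue_on \<Omega>)
        = (\<integral>\<^sup>+x. liminf (\<lambda>k. ennreal ((norm (u m x - u (r k) x))\<^sup>2)) \<partial>lebesgue_on \<Omega>)"
    proof (rule nn_integral_cong_AE)
      show "AE x in lebesgue_on \<Omega>. ennreal ((norm (u m x - p x))\<^sup>2)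
          = liminf (\<lambda>k. ennreal ((norm (u m x - u (r k) x))\<^sup>2))"
        using conv
      proof eventually_elim
        case (elim x)
        then have "(\<lambda>k. u (r k) x) \<longlonglongrightarrow> p x"
          unfolding p_def by (simp add: convergent_LIMSEQ_iff)
        then have "(\<lambda>k. ennreal ((norm (u m x - u (r k) x))\<^sup>2)) \<longlonglongrightarrow> ennreal ((norm (u m x - p x))\<^sup>2)"
          by (intro tendsto_ennrealI tendsto_intros)
        then show ?case by (intro lim_imp_Liminf[symmetric]) auto
      qed
    qed
    also have "\<dots> \<le> liminf (\<lambda>k. \<integral>\<^sup>+x. ennreal ((norm (u m x - u (r k) x))\<^sup>2) \<partial>lebesgue_on \<Omega>)"
      by (rule nn_integral_liminf) measurable
    also have "\<dots> = liminf (\<lambda>k. ennreal ((L2_norm \<Omega> (\<lambda>x. u m x - u (r k) x))\<^sup>2))"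
      by (simp add: nn_integral_norm_power2 L2_diff u)
    also have "\<dots> \<le> limsup (\<lambda>k. ennreal ((L2_norm \<Omega> (\<lambda>x. u m x - u (r k) x))\<^sup>2))"
      by (rule Liminf_le_Limsup) simp
    also have "\<dots> \<le> ennreal (e\<^sup>2)"
    proof (rule Limsup_bounded)
      show "\<forall>\<^sub>F k in sequentially.
          ennreal ((L2_norm \<Omega> (\<lambda>x. u m x - u (r k) x))\<^sup>2) \<le> ennreal (e\<^sup>2)"
        using eventually_ge_at_top[of K]
      proof eventually_elim
        case (elim k)
        then have "L2_norm \<Omega> (\<lambda>x. u m x - u (r k) x) \<le> e"
          using m rge[of k] by (meson le_trans less_imp_le)
        then show ?case by (intro ennreal_leI power_mono) auto
      qed
    qed
    finally show ?thesis .
  qed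
  have diffL: "(\<lambda>x. u m x - p x) \<in> L2 \<Omega>"
    if "\<forall>n\<ge>K. L2_norm \<Omega> (\<lambda>x. u m x - u n x) < e" "0 < e" for m K e
    using bound[OF that] unfolding L2_def
    by (auto intro!: integrableI_bounded simp: top_unique le_less_trans)
  have pL: "p \<in> L2 \<Omega>"
  proof -
    obtain K where "\<forall>m\<ge>K. \<forall>n\<ge>K. L2_norm \<Omega> (\<lambda>x. u m x - u n x) < 1"
      using Cauchy[of 1] by auto
    then have "(\<lambda>x. u K x - p x) \<in> L2 \<Omega>" by (intro diffL[of K K 1]) auto
    from L2_diff[OF u[of K] this] show ?thesis by simp
  qed
  have "(\<lambda>n. L2_norm \<Omega> (\<lambda>x. u n x - p x)) \<longlonglongrightarrow> 0"
  proof (rule LIMSEQ_I)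
    fix e :: real assume "0 < e"
    then obtain K where K: "\<forall>m\<ge>K. \<forall>n\<ge>K. L2_norm \<Omega> (\<lambda>x. u m x - u n x) < e/2"
      using Cauchy[of "e/2"] by auto
    show "\<exists>no. \<forall>n\<ge>no. norm (L2_norm \<Omega> (\<lambda>x. u n x - p x) - 0) < e"
    proof (intro exI allI impI)
      fix m assume "K \<le> m"
      then have "ennreal ((L2_norm \<Omega> (\<lambda>x. u m x - p x))\<^sup>2) \<le> ennreal ((e/2)\<^sup>2)"
        using bound[of K m "e/2"] K \<open>0 < e\<close> by (simp add: nn_integral_norm_power2 L2_diff u pL)
      then have "(L2_norm \<Omega> (\<lambda>x. u m x - p x))\<^sup>2 \<le> (e/2)\<^sup>2" by simp
      then have "L2_norm \<Omega> (\<lambda>x. u m x - p x) \<le> e/2"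
        by (rule power2_le_imp_le) (use \<open>0 < e\<close> in simp)
      then show "norm (L2_norm \<Omega> (\<lambda>x. u m x - p x) - 0) < e" using \<open>0 < e\<close> by simp
    qed
  qed
  with pL show ?thesis by blast
qed

section \<open>Orthogonal projections\<close>

text \<open>Convergence is in the seminorm, so closedness also puts into \<open>V\<close> every
  square-integrable function that agrees almost everywhere with a member of
  \<open>V\<close>.\<close>

definition closed_L2_subspace ::
  "(real^'n) set \<Rightarrow> (real^'n \<Rightarrow> 'b::euclidean_space) set \<Rightarrow> bool" where
  "closed_L2_subspace \<Omega> V \<longleftrightarrow>
     V \<subseteq> L2 \<Omega> \<and> (\<lambda>x. 0) \<in> V \<and>
     (\<forall>f\<in>V. \<forall>g\<in>V. (\<lambda>x. f x + g x) \<in> V) \<and>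
     (\<forall>c. \<forall>f\<in>V. (\<lambda>x. c *\<^sub>R f x) \<in> V) \<and>
     (\<forall>u p. (\<forall>n. u n \<in> V) \<longrightarrow> p \<in> L2 \<Omega> \<longrightarrow>
        (\<lambda>n. L2_norm \<Omega> (\<lambda>x. u n x - p x)) \<longlonglongrightarrow> 0 \<longrightarrow> p \<in> V)"

lemma closed_L2_subspaceD:
  assumes "closed_L2_subspace \<Omega> V"
  shows "f \<in> V \<Longrightarrow> f \<in> L2 \<Omega>" and "(\<lambda>x. 0) \<in> V"
    and "f \<in> V \<Longrightarrow> g \<in> V \<Longrightarrow> (\<lambda>x. f x + g x) \<in> V"
    and "f \<in> V \<Longrightarrow> (\<lambda>x. c *\<^sub>R f x) \<in> V"
    and "(\<And>n. u n \<in> V) \<Longrightarrow> p \<in> L2 \<Omega> \<Longrightarrow> (\<lambda>n. L2_norm \<Omega> (\<lambda>x. u n x - p x)) \<longlonglongrightarrow> 0 \<Longrightarrow> p \<in> V"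
  using assms unfolding closed_L2_subspace_def by blast+

lemma closed_L2_subspace_diff:
  assumes "closed_L2_subspace \<Omega> V" "f \<in> V" "g \<in> V"
  shows "(\<lambda>x. f x - g x) \<in> V"
  using closed_L2_subspaceD(3)[OF assms(1,2) closed_L2_subspaceD(4)[OF assms(1,3), of "-1"]]
  by simp

lemma L2_norm_add_tendsto_0:
  assumes L: "\<And>n. u n \<in> L2 \<Omega>" "\<And>n. v n \<in> L2 \<Omega>" "f \<in> L2 \<Omega>" "g \<in> L2 \<Omega>"
    and lim: "(\<lambda>n. L2_norm \<Omega> (\<lambda>x. u n x - f x)) \<longlonglongrightarrow> 0" "(\<lambda>n. L2_norm \<Omega> (\<lambda>x. v n x - g x)) \<longlonglongrightarrow> 0"
  shows "(\<lambda>n. L2_norm \<Omega> (\<lambda>x. (u n x + v n x) - (f x + g x))) \<longlonglongrightarrow> 0"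
proof (rule Lim_null_comparison)
  show "\<forall>\<^sub>F n in sequentially. norm (L2_norm \<Omega> (\<lambda>x. (u n x + v n x) - (f x + g x)))
      \<le> L2_norm \<Omega> (\<lambda>x. u n x - f x) + L2_norm \<Omega> (\<lambda>x. v n x - g x)"
    using L2_norm_triangle[OF L2_diff[OF L(1) L(3)] L2_diff[OF L(2) L(4)]]
    by (intro always_eventually allI) (simp add: add_diff_add)
  show "(\<lambda>n. L2_norm \<Omega> (\<lambda>x. u n x - f x) + L2_norm \<Omega> (\<lambda>x. v n x - g x)) \<longlonglongrightarrow> 0"
    using tendsto_add[OF lim] by simp
qed

lemma L2_norm_scale_tendsto_0:
  assumes "(\<lambda>n. L2_norm \<Omega> (\<lambda>x. u n x - f x)) \<longlonglongrightarrow> 0"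
  shows "(\<lambda>n. L2_norm \<Omega> (\<lambda>x. c *\<^sub>R u n x - c *\<^sub>R f x)) \<longlonglongrightarrow> 0"
  using tendsto_mult_left[OF assms, of "\<bar>c\<bar>"] by (simp add: L2_norm_scale flip: scaleR_diff_right)

lemma closed_L2_subspace_closure:
  fixes A :: "(real^'n \<Rightarrow> 'b::euclidean_space) set"
  assumes A: "A \<subseteq> L2 \<Omega>" and zero: "(\<lambda>x. 0) \<in> A"
    and add: "\<And>f g. f \<in> A \<Longrightarrow> g \<in> A \<Longrightarrow> (\<lambda>x. f x + g x) \<in> A"
    and scale: "\<And>c f. f \<in> A \<Longrightarrow> (\<lambda>x. c *\<^sub>R f x) \<in> A"
  shows "closed_L2_subspace \<Omega> (L2_closure \<Omega> A)"
  unfolding closed_L2_subspace_def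
proof (intro conjI ballI allI impI)
  show "L2_closure \<Omega> A \<subseteq> L2 \<Omega>" by (auto simp: L2_closure_def)
  show "(\<lambda>x. 0) \<in> L2_closure \<Omega> A"
    using zero by (auto simp: L2_closure_def L2_zero intro!: exI[of _ "\<lambda>n x. 0"])
next
  fix f g assume f: "f \<in> L2_closure \<Omega> A" and g: "g \<in> L2_closure \<Omega> A"
  then obtain u v where u: "\<And>n. u n \<in> A" "(\<lambda>n. L2_norm \<Omega> (\<lambda>x. u n x - f x)) \<longlonglongrightarrow> 0"
    and v: "\<And>n. v n \<in> A" "(\<lambda>n. L2_norm \<Omega> (\<lambda>x. v n x - g x)) \<longlonglongrightarrow> 0"
    unfolding L2_closure_def by blast
  have fg: "f \<in> L2 \<Omega>" "g \<in> L2 \<Omega>" using f g by (auto simp: L2_closure_def)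
  have "(\<lambda>n. L2_norm \<Omega> (\<lambda>x. (u n x + v n x) - (f x + g x))) \<longlonglongrightarrow> 0"
    using u v fg A by (intro L2_norm_add_tendsto_0) auto
  then show "(\<lambda>x. f x + g x) \<in> L2_closure \<Omega> A"
    unfolding L2_closure_def using fg u(1) v(1) add
    by (auto intro!: L2_add exI[of _ "\<lambda>n x. u n x + v n x"])
next
  fix f c assume f: "f \<in> L2_closure \<Omega> A"
  then obtain u where u: "\<And>n. u n \<in> A" "(\<lambda>n. L2_norm \<Omega> (\<lambda>x. u n x - f x)) \<longlonglongrightarrow> 0"
    unfolding L2_closure_def by blast
  from L2_norm_scale_tendsto_0[OF u(2)]
  have "(\<lambda>n. L2_norm \<Omega> (\<lambda>x. c *\<^sub>R u n x - c *\<^sub>R f x)) \<longlonglongrightarrow> 0" .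
  then show "(\<lambda>x. c *\<^sub>R f x) \<in> L2_closure \<Omega> A"
    using f u(1) scale by (auto simp: L2_closure_def intro!: L2_scale exI[of _ "\<lambda>n x. c *\<^sub>R u n x"])
next
  fix u p
  assume u: "\<forall>n. u n \<in> L2_closure \<Omega> A" and p: "p \<in> L2 \<Omega>"
    and lim: "(\<lambda>n. L2_norm \<Omega> (\<lambda>x. u n x - p x)) \<longlonglongrightarrow> 0"
  \<comment> \<open>The closure is defined by sequences from \<open>A\<close>, so a limit of members
    of the closure needs a diagonal choice: one element of \<open>A\<close> within
    \<open>1/(n+1)\<close> of each \<open>u n\<close>.\<close>
  have "\<exists>v\<in>A. L2_norm \<Omega> (\<lambda>x. v x - u n x) < inverse (Suc n)" for n
  proof -
    from u obtain w where w: "\<And>m. w m \<in> A" "(\<lambda>m. L2_norm \<Omega> (\<lambda>x. w m x - u n x)) \<longlonglongrightarrow> 0"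
      unfolding L2_closure_def by blast
    have "\<forall>\<^sub>F m in sequentially. L2_norm \<Omega> (\<lambda>x. w m x - u n x) < inverse (Suc n)"
      by (rule order_tendstoD(2)[OF w(2)]) simp
    then show ?thesis using w(1) by (auto simp: eventually_sequentially)
  qed
  then obtain v where v: "\<And>n. v n \<in> A" "\<And>n. L2_norm \<Omega> (\<lambda>x. v n x - u n x) < inverse (Suc n)"
    by metis
  have "(\<lambda>n. L2_norm \<Omega> (\<lambda>x. v n x - p x)) \<longlonglongrightarrow> 0"
  proof (rule Lim_null_comparison)
    show "\<forall>\<^sub>F n in sequentially. norm (L2_norm \<Omega> (\<lambda>x. v n x - p x))
        \<le> inverse (Suc n) + L2_norm \<Omega> (\<lambda>x. u n x - p x)"
    proof (rule always_eventually, rule allI)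
      fix n
      have "v n \<in> L2 \<Omega>" "u n \<in> L2 \<Omega>" using v u A by (auto simp: L2_closure_def)
      then have "L2_norm \<Omega> (\<lambda>x. v n x - p x)
          \<le> L2_norm \<Omega> (\<lambda>x. v n x - u n x) + L2_norm \<Omega> (\<lambda>x. u n x - p x)"
        using p by (intro L2_norm_triangle_diff)
      then show "norm (L2_norm \<Omega> (\<lambda>x. v n x - p x)) \<le> inverse (Suc n) + L2_norm \<Omega> (\<lambda>x. u n x - p x)"
        using v(2)[of n] by simp
    qed
    show "(\<lambda>n. inverse (Suc n) + L2_norm \<Omega> (\<lambda>x. u n x - p x)) \<longlonglongrightarrow> 0"
      using tendsto_add[OF LIMSEQ_inverse_real_of_nat lim] by simp
  qed
  then show "p \<in> L2_closure \<Omega> A" using v(1) p by (auto simp: L2_closure_def)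
qed

text \<open>The parallelogram law makes a minimising sequence for the distance from \<open>k\<close> to \<open>V\<close>
  a Cauchy sequence.\<close>

lemma L2_minimiser_exists:
  assumes V: "closed_L2_subspace \<Omega> V" and k: "k \<in> L2 \<Omega>"
  shows "\<exists>p\<in>V. \<forall>v\<in>V. L2_norm \<Omega> (\<lambda>x. k x - p x) \<le> L2_norm \<Omega> (\<lambda>x. k x - v x)"
proof -
  \<comment> \<open>Squared distances are used because the parallelogram law is linear in
    squares.\<close>
  define Q where "Q v = (L2_norm \<Omega> (\<lambda>x. k x - v x))\<^sup>2" for v
  define d where "d = Inf (Q ` V)"
  have bdd: "bdd_below (Q ` V)" by (rule bdd_belowI[of _ 0]) (auto simp: Q_def)
  have ne: "Q ` V \<noteq> {}" using closed_L2_subspaceD(2)[OF V] by auto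
  have dle: "d \<le> Q v" if "v \<in> V" for v
    unfolding d_def using that bdd by (intro cInf_lower) auto
  have "\<exists>v\<in>V. Q v < d + inverse (Suc n)" for n
  proof -
    have "Inf (Q ` V) < d + inverse (Suc n)" by (simp add: d_def)
    from cInf_lessD[OF ne this] show ?thesis by auto
  qed
  then obtain v where v: "\<And>n. v n \<in> V" and vd: "\<And>n. Q (v n) < d + inverse (Suc n)" by metis
  have vL: "v n \<in> L2 \<Omega>" for n using v V closed_L2_subspaceD(1) by blast
  have close: "(L2_norm \<Omega> (\<lambda>x. v m x - v n x))\<^sup>2 \<le> 2 * inverse (Suc m) + 2 * inverse (Suc n)" for m n
  proof -
    \<comment> \<open>The midpoint of \<open>v m\<close> and \<open>v n\<close> lies in
      \<open>V\<close>, so its squared distance from \<open>k\<close> is at least \<open>d\<close>.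
      This bounds the sum term of the parallelogram law below by \<open>4 * d\<close> and leaves
      little for the difference.\<close>
    have "(\<lambda>x. (1/2) *\<^sub>R (v m x + v n x)) \<in> V"
      using v V by (intro closed_L2_subspaceD(3,4))
    from dle[OF this] have "4 * d \<le> 4 * (L2_norm \<Omega> (\<lambda>x. k x - (1/2) *\<^sub>R (v m x + v n x)))\<^sup>2"
      by (simp add: Q_def)
    also have "\<dots> = (L2_norm \<Omega> (\<lambda>x. 2 *\<^sub>R (k x - (1/2) *\<^sub>R (v m x + v n x))))\<^sup>2"
      by (simp only: L2_norm_scale power_mult_distrib) simp
    also have "(\<lambda>x. 2 *\<^sub>R (k x - (1/2) *\<^sub>R (v m x + v n x))) = (\<lambda>x. (k x - v n x) + (k x - v m x))"
      by (simp add: fun_eq_iff algebra_simps scaleR_2)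
    finally have "4 * d \<le> (L2_norm \<Omega> (\<lambda>x. (k x - v n x) + (k x - v m x)))\<^sup>2" .
    moreover have "(L2_norm \<Omega> (\<lambda>x. (k x - v n x) - (k x - v m x)))\<^sup>2
        + (L2_norm \<Omega> (\<lambda>x. (k x - v n x) + (k x - v m x)))\<^sup>2 = 2 * Q (v n) + 2 * Q (v m)"
      unfolding Q_def by (intro L2_parallelogram L2_diff k vL)
    moreover have "(\<lambda>x. (k x - v n x) - (k x - v m x)) = (\<lambda>x. v m x - v n x)" by auto
    ultimately show ?thesis using vd[of m] vd[of n] by simp
  qed
  have "\<exists>p\<in>L2 \<Omega>. (\<lambda>n. L2_norm \<Omega> (\<lambda>x. v n x - p x)) \<longlonglongrightarrow> 0"
  proof (rule L2_complete[OF vL])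
    fix e :: real assume "0 < e"
    then obtain N where N: "inverse (Suc N) < e\<^sup>2 / 4"
      using reals_Archimedean[of "e\<^sup>2 / 4"] by auto
    have "L2_norm \<Omega> (\<lambda>x. v m x - v n x) < e" if "N \<le> m" "N \<le> n" for m n
    proof -
      have "inverse (real (Suc m)) \<le> inverse (Suc N)" "inverse (real (Suc n)) \<le> inverse (Suc N)"
        using that by (auto intro!: le_imp_inverse_le)
      with close[of m n] N have "(L2_norm \<Omega> (\<lambda>x. v m x - v n x))\<^sup>2 < e\<^sup>2" by linarith
      then show ?thesis by (rule power2_less_imp_less) (use \<open>0 < e\<close> in simp)
    qed
    then show "\<exists>N. \<forall>m\<ge>N. \<forall>n\<ge>N. L2_norm \<Omega> (\<lambda>x. v m x - v n x) < e" by blast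
  qed
  then obtain p where p: "p \<in> L2 \<Omega>" and lim: "(\<lambda>n. L2_norm \<Omega> (\<lambda>x. v n x - p x)) \<longlonglongrightarrow> 0" by blast
  have pV: "p \<in> V" using closed_L2_subspaceD(5)[OF V v p lim] .
  have "L2_norm \<Omega> (\<lambda>x. k x - p x) \<le> sqrt d"
  proof (rule LIMSEQ_le_const)
    have "(\<lambda>n. sqrt (d + inverse (Suc n)) + L2_norm \<Omega> (\<lambda>x. v n x - p x)) \<longlonglongrightarrow> sqrt (d + 0) + 0"
      by (intro tendsto_add tendsto_real_sqrt tendsto_const LIMSEQ_inverse_real_of_nat lim)
    then show "(\<lambda>n. sqrt (d + inverse (Suc n)) + L2_norm \<Omega> (\<lambda>x. v n x - p x)) \<longlonglongrightarrow> sqrt d" by simp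
    have "L2_norm \<Omega> (\<lambda>x. k x - p x) \<le> sqrt (d + inverse (Suc n)) + L2_norm \<Omega> (\<lambda>x. v n x - p x)" for n
    proof -
      have "L2_norm \<Omega> (\<lambda>x. k x - v n x) \<le> sqrt (d + inverse (Suc n))"
        using vd[of n] by (intro real_le_rsqrt) (simp add: Q_def)
      with L2_norm_triangle_diff[OF k vL[of n] p] show ?thesis by linarith
    qed
    then show "\<exists>N. \<forall>n\<ge>N. L2_norm \<Omega> (\<lambda>x. k x - p x)
        \<le> sqrt (d + inverse (Suc n)) + L2_norm \<Omega> (\<lambda>x. v n x - p x)" by blast
  qed
  moreover have "sqrt d \<le> L2_norm \<Omega> (\<lambda>x. k x - w x)" if "w \<in> V" for w
    using dle[OF that] by (simp add: Q_def real_le_lsqrt)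
  ultimately show ?thesis using pV by (meson order_trans)
qed

text \<open>Orthogonality is the first-order condition at the minimiser: \<open>p + t v\<close> is a
  competitor for every real \<open>t\<close>.\<close>

lemma L2_projection_exists:
  assumes V: "closed_L2_subspace \<Omega> V" and k: "k \<in> L2 \<Omega>"
  shows "\<exists>p. is_L2_projection \<Omega> V k p"
proof -
  obtain p where p: "p \<in> V"
    and min: "\<And>v. v \<in> V \<Longrightarrow> L2_norm \<Omega> (\<lambda>x. k x - p x) \<le> L2_norm \<Omega> (\<lambda>x. k x - v x)"
    using L2_minimiser_exists[OF assms] by blast
  define r where "r x = k x - p x" for x
  have rL: "r \<in> L2 \<Omega>"
    unfolding r_def using k closed_L2_subspaceD(1)[OF V p] by (rule L2_diff)
  have "L2_inner \<Omega> r v = 0" if v: "v \<in> V" for v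
  proof -
    let ?B = "L2_inner \<Omega> r v" and ?C = "L2_inner \<Omega> v v"
    have vL: "v \<in> L2 \<Omega>" using closed_L2_subspaceD(1)[OF V v] .
    have var: "2 * t * ?B \<le> t\<^sup>2 * ?C" for t
    proof -
      have "(\<lambda>x. p x + t *\<^sub>R v x) \<in> V" using p v by (intro closed_L2_subspaceD(3,4)[OF V])
      from min[OF this] have "(L2_norm \<Omega> r)\<^sup>2 \<le> (L2_norm \<Omega> (\<lambda>x. r x - t *\<^sub>R v x))\<^sup>2"
        unfolding r_def by (intro power_mono) (auto simp: diff_diff_eq)
      also have "\<dots> = (L2_norm \<Omega> r)\<^sup>2 - 2 * t * ?B + t\<^sup>2 * ?C"
        using rL vL unfolding L2_norm_power2
        by (simp add: L2_inner_diff_left L2_inner_diff_right L2_scale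
            L2_diff L2_inner_scale_left L2_inner_scale_right L2_inner_commute[of \<Omega> v r]
            algebra_simps power2_eq_square)
      finally show ?thesis by simp
    qed
    have C: "0 \<le> ?C" by (simp flip: L2_norm_power2)
    \<comment> \<open>The optimal step would be \<open>?B / ?C\<close>. Adding 1 avoids division by
      zero for a null \<open>v\<close> and still leaves
      \<open>t\<^sup>2 * (?C + 2) \<le> 0\<close>.\<close>
    define t where "t = ?B / (?C + 1)"
    have t: "?B = t * (?C + 1)" using C by (simp add: t_def)
    have "2 * t * (t * (?C + 1)) \<le> t\<^sup>2 * ?C" using var[of t] t by simp
    then have "t\<^sup>2 * (?C + 2) \<le> 0" by (simp add: algebra_simps power2_eq_square)
    with C have "t = 0" by (simp add: mult_le_0_iff)
    with t have "?B = 0" by simp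
    then show ?thesis by simp
  qed
  with p show ?thesis unfolding is_L2_projection_def r_def by blast
qed

text \<open>The two residuals are orthogonal to \<open>V\<close> and differ by \<open>p - q\<close>,
  which itself lies in \<open>V\<close>; hence \<open>p - q\<close> is orthogonal to itself and
  null.\<close>

lemma L2_norm_projection_unique:
  assumes V: "closed_L2_subspace \<Omega> V" and k: "k \<in> L2 \<Omega>"
    and p: "is_L2_projection \<Omega> V k p" and q: "is_L2_projection \<Omega> V k q"
  shows "L2_norm \<Omega> p = L2_norm \<Omega> q"
proof -
  have pV: "p \<in> V" and qV: "q \<in> V" using p q by (auto simp: is_L2_projection_def)
  have L: "p \<in> L2 \<Omega>" "q \<in> L2 \<Omega>" using closed_L2_subspaceD(1)[OF V] pV qV by auto
  let ?h = "\<lambda>x. p x - q x"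
  have h: "?h \<in> V" using pV qV by (rule closed_L2_subspace_diff[OF V])
  have "L2_inner \<Omega> ?h ?h = L2_inner \<Omega> (\<lambda>x. k x - q x) ?h - L2_inner \<Omega> (\<lambda>x. k x - p x) ?h"
    using L k by (simp add: L2_inner_diff_left L2_diff)
  also have "\<dots> = 0" using p q h by (simp add: is_L2_projection_def)
  finally have "L2_norm \<Omega> ?h = 0" by (simp flip: L2_norm_power2)
  then have "AE x in lebesgue_on \<Omega>. p x = q x"
    using L2_norm_eq_0_iff[OF L2_diff[OF L]] by simp
  with L show ?thesis by (rule L2_norm_cong_AE)
qed

lemma is_L2_projection_cong_AE:
  assumes V: "closed_L2_subspace \<Omega> V" and k: "k \<in> L2 \<Omega>" and k': "k' \<in> L2 \<Omega>"
    and eq: "AE x in lebesgue_on \<Omega>. k x = k' x" and p: "is_L2_projection \<Omega> V k p"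
  shows "is_L2_projection \<Omega> V k' p"
proof -
  have pV: "p \<in> V" using p by (simp add: is_L2_projection_def)
  have pL: "p \<in> L2 \<Omega>" using closed_L2_subspaceD(1)[OF V pV] .
  have "L2_inner \<Omega> (\<lambda>x. k' x - p x) v = L2_inner \<Omega> (\<lambda>x. k x - p x) v" if "v \<in> V" for v
  proof (rule L2_inner_cong_AE)
    show "AE x in lebesgue_on \<Omega>. k' x - p x = k x - p x" using eq by eventually_elim simp
  qed (use k k' pL closed_L2_subspaceD(1)[OF V that] in \<open>auto intro: L2_diff\<close>)
  with p show ?thesis by (simp add: is_L2_projection_def)
qed

lemma is_L2_projection_add:
  assumes V: "closed_L2_subspace \<Omega> V" and k: "k \<in> L2 \<Omega>" "l \<in> L2 \<Omega>"
    and p: "is_L2_projection \<Omega> V k p" and q: "is_L2_projection \<Omega> V l q"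
  shows "is_L2_projection \<Omega> V (\<lambda>x. k x + l x) (\<lambda>x. p x + q x)"
proof -
  have pV: "p \<in> V" and qV: "q \<in> V" using p q by (auto simp: is_L2_projection_def)
  have L: "p \<in> L2 \<Omega>" "q \<in> L2 \<Omega>" using closed_L2_subspaceD(1)[OF V] pV qV by auto
  have "L2_inner \<Omega> (\<lambda>x. (k x + l x) - (p x + q x)) v = 0" if "v \<in> V" for v
    using L2_inner_add_left[of "\<lambda>x. k x - p x" \<Omega> "\<lambda>x. l x - q x" v]
      p q that L k closed_L2_subspaceD(1)[OF V that]
    by (simp add: is_L2_projection_def L2_diff add_diff_add)
  then show ?thesis
    using closed_L2_subspaceD(3)[OF V pV qV] by (simp add: is_L2_projection_def)
qed

lemma is_L2_projection_scale:
  assumes V: "closed_L2_subspace \<Omega> V" and p: "is_L2_projection \<Omega> V k p"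
  shows "is_L2_projection \<Omega> V (\<lambda>x. c *\<^sub>R k x) (\<lambda>x. c *\<^sub>R p x)"
  using p closed_L2_subspaceD(4)[OF V, of p c]
  by (simp add: is_L2_projection_def L2_inner_scale_left flip: scaleR_diff_right)

section \<open>Test functions and integration by parts\<close>

lemma partial_deriv_eq:
  assumes "(f has_derivative D) (at x)"
  shows "partial_deriv i f x = D (axis i 1)"
  using frechet_derivative_at[OF assms] by (simp add: partial_deriv_def)

lemma partial_deriv_const [simp]: "partial_deriv i (\<lambda>x. c) = (\<lambda>x. 0)"
  by (rule ext) (simp add: partial_deriv_eq[OF has_derivative_const])

lemma partial_deriv_add:
  assumes "f differentiable (at x)" "g differentiable (at x)"
  shows "partial_deriv i (\<lambda>x. f x + g x) x = partial_deriv i f x + partial_deriv i g x"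
  using partial_deriv_eq[OF has_derivative_add[OF assms[unfolded frechet_derivative_works]]]
  by (simp add: partial_deriv_def)

lemma partial_deriv_mult:
  assumes "f differentiable (at x)" "g differentiable (at x)"
  shows "partial_deriv i (\<lambda>x. f x * g x) x = f x * partial_deriv i g x + partial_deriv i f x * g x"
  using partial_deriv_eq[OF has_derivative_mult[OF assms[unfolded frechet_derivative_works]]]
  by (simp add: partial_deriv_def)

lemma partial_deriv_cmult:
  assumes "f differentiable (at x)"
  shows "partial_deriv i (\<lambda>x. c * f x) x = c * partial_deriv i f x"
  using partial_deriv_mult[of "\<lambda>x. c" x f i] assms by simp

lemma differentiable_imp_continuous_UNIV:
  "(\<And>x. f differentiable (at x)) \<Longrightarrow> continuous_on UNIV f"
  by (simp add: continuous_at_imp_continuous_on differentiable_imp_continuous_within)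

text \<open>The recursion of \<open>Ck\<close> constrains \<open>f\<close> itself only through
  differentiability, so the inclusion needs an induction whose base case is that differentiable
  functions are continuous.\<close>

lemma Ck_Suc_imp_Ck: "Ck (Suc k) f \<Longrightarrow> Ck k f"
proof (induction k arbitrary: f)
  case 0
  then show ?case by (simp add: differentiable_imp_continuous_UNIV)
next
  case (Suc k)
  from Suc.prems[unfolded Ck.simps(2)[of "Suc k"]] Suc.IH
  show ?case unfolding Ck.simps(2)[of k] by blast
qed

lemma Ck_const: "Ck k (\<lambda>x. c)"
  by (induction k arbitrary: c) simp_all

lemma Ck_add: "Ck k f \<Longrightarrow> Ck k g \<Longrightarrow> Ck k (\<lambda>x. f x + g x)"
proof (induction k arbitrary: f g)
  case (Suc k)
  then have "partial_deriv i (\<lambda>x. f x + g x) = (\<lambda>x. partial_deriv i f x + partial_deriv i g x)" for i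
    by (auto simp: partial_deriv_add)
  with Suc show ?case by simp
qed (auto intro: continuous_on_add)

text \<open>The product rule keeps one factor undifferentiated, and the induction hypothesis needs
  that factor at order \<open>k\<close>; \<open>Ck_Suc_imp_Ck\<close> supplies this.\<close>

lemma Ck_mult: "Ck k f \<Longrightarrow> Ck k g \<Longrightarrow> Ck k (\<lambda>x. f x * g x)"
proof (induction k arbitrary: f g)
  case (Suc k)
  then have "partial_deriv i (\<lambda>x. f x * g x)
      = (\<lambda>x. f x * partial_deriv i g x + partial_deriv i f x * g x)" for i
    by (auto simp: partial_deriv_mult)
  with Suc Ck_Suc_imp_Ck[OF Suc.prems(1)] Ck_Suc_imp_Ck[OF Suc.prems(2)] show ?case
    by (simp add: Ck_add)
qed (auto intro: continuous_on_mult)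

lemma Ck_prod: "(\<And>j. j \<in> J \<Longrightarrow> Ck k (f j)) \<Longrightarrow> Ck k (\<lambda>x. \<Prod>j\<in>J. f j x)"
  by (induction J rule: infinite_finite_induct) (simp_all add: Ck_const Ck_mult)

lemma Ck_coordinate: "Ck k (\<lambda>x::real^'n. x $ j)"
proof -
  have der: "((\<lambda>x::real^'n. x $ j) has_derivative (\<lambda>h. h $ j)) (at x)" for x
    by (intro bounded_linear_imp_has_derivative bounded_linear_vec_nth)
  have "partial_deriv i (\<lambda>x::real^'n. x $ j) = (\<lambda>x. axis i 1 $ j)" for i :: 'n
    by (rule ext) (rule partial_deriv_eq[OF der])
  moreover have "(\<lambda>x :: real^'n. x $ j) differentiable (at x)" for x
    using der by (auto simp: differentiable_def)
  ultimately show ?thesis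
    by (cases k) (auto simp: Ck_const intro!: continuous_intros)
qed

section \<open>Test functions, handled through any compact set outside which they vanish\<close>

lemma test_functionsI:
  assumes "\<And>k. Ck k f" and K: "compact K" "K \<subseteq> \<Omega>" "\<And>x. x \<notin> K \<Longrightarrow> f x = 0"
  shows "f \<in> test_functions \<Omega>"
proof -
  have sub: "closure {x. f x \<noteq> 0} \<subseteq> K"
    using K by (intro closure_minimal compact_imp_closed) auto
  then have "compact (closure {x. f x \<noteq> 0})"
    using K(1) closed_Int_compact[of "closure {x. f x \<noteq> 0}" K] by (simp add: Int_absorb2)
  with assms(1) K(2) sub show ?thesis by (simp add: test_functions_def)
qed

lemma test_functionsE:
  assumes "f \<in> test_functions \<Omega>"
  obtains K where "compact K" "K \<subseteq> \<Omega>" "\<And>x. x \<notin> K \<Longrightarrow> f x = 0"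
proof
  show "compact (closure {x. f x \<noteq> 0})" "closure {x. f x \<noteq> 0} \<subseteq> \<Omega>"
    using assms by (simp_all add: test_functions_def)
  show "f x = 0" if "x \<notin> closure {x. f x \<noteq> 0}" for x
    using that closure_subset[of "{x. f x \<noteq> 0}"] by auto
qed

lemma test_functions_Ck: "f \<in> test_functions \<Omega> \<Longrightarrow> Ck k f"
  by (simp add: test_functions_def)

lemma test_functions_differentiable: "f \<in> test_functions \<Omega> \<Longrightarrow> f differentiable (at x)"
  using test_functions_Ck[of f \<Omega> "Suc 0"] by simp

lemma test_functions_continuous: "f \<in> test_functions \<Omega> \<Longrightarrow> continuous_on UNIV f"
  using test_functions_Ck[of f \<Omega> 0] by simp

lemma test_functions_continuous_partial_deriv:
  "f \<in> test_functions \<Omega> \<Longrightarrow> continuous_on UNIV (partial_deriv i f)"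
  using test_functions_Ck[of f \<Omega> "Suc 0"] by simp

lemma test_functions_zero: "(\<lambda>x. 0) \<in> test_functions \<Omega>"
  by (rule test_functionsI[where K = "{}"]) (simp_all add: Ck_const)

lemma test_functions_add:
  assumes "f \<in> test_functions \<Omega>" "g \<in> test_functions \<Omega>"
  shows "(\<lambda>x. f x + g x) \<in> test_functions \<Omega>"
proof -
  obtain K where K: "compact K" "K \<subseteq> \<Omega>" "\<And>x. x \<notin> K \<Longrightarrow> f x = 0"
    using assms(1) by (rule test_functionsE) blast
  obtain L where L: "compact L" "L \<subseteq> \<Omega>" "\<And>x. x \<notin> L \<Longrightarrow> g x = 0"
    using assms(2) by (rule test_functionsE) blast
  show ?thesis
    by (rule test_functionsI[where K = "K \<union> L"])
      (use assms K L in \<open>auto intro!: Ck_add test_functions_Ck[OF assms(1)] test_functions_Ck[OF assms(2)]\<close>)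
qed

lemma test_functions_mult:
  assumes "\<And>k. Ck k g" "f \<in> test_functions \<Omega>"
  shows "(\<lambda>x. g x * f x) \<in> test_functions \<Omega>"
proof -
  obtain K where K: "compact K" "K \<subseteq> \<Omega>" "\<And>x. x \<notin> K \<Longrightarrow> f x = 0"
    using assms(2) by (rule test_functionsE) blast
  show ?thesis
    by (rule test_functionsI[where K = K])
      (use K in \<open>auto intro!: Ck_mult assms(1) test_functions_Ck[OF assms(2)]\<close>)
qed

lemma test_functions_cmult: "f \<in> test_functions \<Omega> \<Longrightarrow> (\<lambda>x. c * f x) \<in> test_functions \<Omega>"
  by (rule test_functions_mult[OF Ck_const])

lemma partial_deriv_outside_support:
  assumes "closed K" "\<And>x. x \<notin> K \<Longrightarrow> f x = 0" "x \<notin> K"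
  shows "partial_deriv i f x = 0"
proof -
  have "(f has_derivative (\<lambda>h. 0)) (at x)"
    by (rule has_derivative_transform_within_open[OF has_derivative_const, where s = "- K"])
      (use assms in auto)
  then show ?thesis by (simp add: partial_deriv_eq)
qed

lemma gradient_add:
  assumes "f \<in> test_functions \<Omega>" "g \<in> test_functions \<Omega>"
  shows "gradient (\<lambda>x. f x + g x) = (\<lambda>x. gradient f x + gradient g x)"
  using assms by (simp add: fun_eq_iff gradient_def vec_eq_iff partial_deriv_add
      test_functions_differentiable)

lemma gradient_cmult:
  assumes "f \<in> test_functions \<Omega>"
  shows "gradient (\<lambda>x. c * f x) = (\<lambda>x. c *\<^sub>R gradient f x)"
  using assms by (simp add: fun_eq_iff gradient_def vec_eq_iff partial_deriv_cmult
      test_functions_differentiable)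

lemma gradient_zero: "gradient (\<lambda>x. 0) = (\<lambda>x. 0)"
  by (simp add: fun_eq_iff gradient_def vec_eq_iff)

section \<open>Integrals of continuous functions with compact support\<close>

lemma integrable_lborel_compact_support:
  fixes f :: "'a::euclidean_space \<Rightarrow> 'b::{banach, second_countable_topology}"
  assumes "continuous_on UNIV f" "compact K" "\<And>x. x \<notin> K \<Longrightarrow> f x = 0"
  shows "integrable lborel f"
proof -
  have "integrable lborel (\<lambda>x. indicator K x *\<^sub>R f x)"
    using assms by (intro borel_integrable_compact continuous_on_subset[OF assms(1)]) auto
  also have "(\<lambda>x. indicator K x *\<^sub>R f x) = f"
    using assms(3) by (auto simp: indicator_def)
  finally show ?thesis .
qed

lemma continuous_measurable_lebesgue_on:
  "continuous_on UNIV f \<Longrightarrow> f \<in> borel_measurable (lebesgue_on \<Omega>)"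
  by (intro measurable_restrict_space1 measurable_completion)
    (simp add: borel_measurable_continuous_onI)

lemma L2_compact_support:
  fixes f :: "real^'n \<Rightarrow> 'b::euclidean_space"
  assumes "continuous_on UNIV f" "compact K" "\<And>x. x \<notin> K \<Longrightarrow> f x = 0" "\<Omega> \<in> sets lebesgue"
  shows "f \<in> L2 \<Omega>"
proof -
  have "continuous_on UNIV (\<lambda>x. (norm (f x))\<^sup>2)" by (intro continuous_intros assms)
  then have "integrable lborel (\<lambda>x. (norm (f x))\<^sup>2)"
    by (rule integrable_lborel_compact_support[OF _ assms(2)]) (use assms(3) in auto)
  then have "integrable lebesgue (\<lambda>x. (norm (f x))\<^sup>2)"
    by (simp add: integrable_completion)
  then have "integrable (lebesgue_on \<Omega>) (\<lambda>x. (norm (f x))\<^sup>2)"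
    using assms(4) integrable_mult_indicator[of \<Omega> lebesgue "\<lambda>x. (norm (f x))\<^sup>2"]
    by (simp add: integrable_restrict_space)
  then show ?thesis
    using assms(1) by (simp add: L2_def continuous_measurable_lebesgue_on)
qed

text \<open>Zero extension moves the integral to \<open>lborel\<close> on the whole space, where
  translations preserve the measure.\<close>

lemma integral_lebesgue_on_eq_lborel:
  fixes f :: "'a::euclidean_space \<Rightarrow> 'b::{banach, second_countable_topology}"
  assumes "continuous_on UNIV f" "\<And>x. x \<notin> \<Omega> \<Longrightarrow> f x = 0" "\<Omega> \<in> sets lebesgue"
  shows "(\<integral>x. f x \<partial>lebesgue_on \<Omega>) = (\<integral>x. f x \<partial>lborel)"
proof -
  have "(\<integral>x. f x \<partial>lebesgue_on \<Omega>) = (\<integral>x. indicator \<Omega> x *\<^sub>R f x \<partial>lebesgue)"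
    using assms(3) by (simp add: integral_restrict_space)
  also have "(\<lambda>x. indicator \<Omega> x *\<^sub>R f x) = f"
    using assms(2) by (auto simp: indicator_def)
  also have "(\<integral>x. f x \<partial>lebesgue) = (\<integral>x. f x \<partial>lborel)"
    by (rule integral_completion) (use assms(1) borel_measurable_continuous_onI in auto)
  finally show ?thesis .
qed

section \<open>Integration by parts\<close>

lemma has_real_derivative_along_axis:
  assumes "\<And>x. F differentiable (at x)"
  shows "((\<lambda>t. F (x + t *\<^sub>R axis i 1)) has_real_derivative partial_deriv i F (x + t *\<^sub>R axis i 1)) (at t)"
proof -
  let ?y = "x + t *\<^sub>R axis i 1"
  let ?D = "frechet_derivative F (at ?y)"
  have D: "(F has_derivative ?D) (at ?y)" using assms frechet_derivative_works by blast
  have "((\<lambda>t. x + t *\<^sub>R axis i 1) has_derivative (\<lambda>h. h *\<^sub>R axis i 1)) (at t)"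
    by (auto intro!: derivative_eq_intros)
  from has_derivative_compose[OF this D]
  have "((\<lambda>t. F (x + t *\<^sub>R axis i 1)) has_derivative (\<lambda>h. ?D (h *\<^sub>R axis i 1))) (at t)" .
  moreover have "?D (h *\<^sub>R axis i 1) = partial_deriv i F ?y * h" for h
    using linear_scale[OF has_derivative_linear[OF D]] by (simp add: partial_deriv_def)
  ultimately show ?thesis by (simp add: has_field_derivative_def)
qed

text \<open>By translation invariance all difference quotients of \<open>F\<close> have integral zero, and they
  converge boundedly to the partial derivative.\<close>

lemma integral_partial_deriv_eq_0:
  fixes F :: "real^'n \<Rightarrow> real"
  assumes diff: "\<And>x. F differentiable (at x)" and cont: "continuous_on UNIV (partial_deriv i F)"
    and K: "compact K" and supp: "\<And>x. x \<notin> K \<Longrightarrow> F x = 0"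
  shows "(\<integral>x. partial_deriv i F x \<partial>lborel) = 0"
proof -
  let ?e = "axis i 1 :: real^'n"
  have contF: "continuous_on UNIV F" using diff by (rule differentiable_imp_continuous_UNIV)
  have Fm[measurable]: "F \<in> borel_measurable borel"
    using contF by (rule borel_measurable_continuous_onI)
  have dm[measurable]: "partial_deriv i F \<in> borel_measurable borel"
    using cont by (rule borel_measurable_continuous_onI)
  have Fint: "integrable lborel F" using contF K supp by (rule integrable_lborel_compact_support)
  have dsupp: "partial_deriv i F x = 0" if "x \<notin> K" for x
    using partial_deriv_outside_support[of K F x i] K supp that by (simp add: compact_imp_closed)
  have "bounded (partial_deriv i F ` K)"
    by (intro compact_imp_bounded compact_continuous_image K continuous_on_subset[OF cont]) simp
  then obtain C where C: "0 < C" "\<And>x. x \<in> K \<Longrightarrow> \<bar>partial_deriv i F x\<bar> \<le> C"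
    by (auto simp: bounded_pos)
  have dC: "\<bar>partial_deriv i F x\<bar> \<le> C" for x
    using C dsupp[of x] by (cases "x \<in> K") auto
  obtain R where R: "\<And>x. x \<in> K \<Longrightarrow> norm x \<le> R"
    using compact_imp_bounded[OF K] by (auto simp: bounded_pos)
  define \<tau> where "\<tau> n = inverse (real (Suc n))" for n
  have \<tau>: "0 < \<tau> n" "\<tau> n \<le> 1" for n by (auto simp: \<tau>_def inverse_le_1_iff)
  define s where "s n x = (F (\<tau> n *\<^sub>R ?e + x) - F x) / \<tau> n" for n x
  have s0: "(\<integral>x. s n x \<partial>lborel) = 0" for n
  proof -
    have Fd: "integrable (distr lborel borel ((+) (\<tau> n *\<^sub>R ?e))) F"
      using Fint by (simp add: lborel_distr_plus)
    then have i: "integrable lborel (\<lambda>x. F (\<tau> n *\<^sub>R ?e + x))"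
      by (rule integrable_distr[rotated]) measurable
    have "(\<integral>x. F (\<tau> n *\<^sub>R ?e + x) \<partial>lborel) = (\<integral>x. F x \<partial>distr lborel borel ((+) (\<tau> n *\<^sub>R ?e)))"
      by (rule integral_distr[symmetric]) measurable
    also have "\<dots> = (\<integral>x. F x \<partial>lborel)" by (simp add: lborel_distr_plus)
    finally show ?thesis using i Fint by (simp add: s_def)
  qed
  have "(\<lambda>n. \<integral>x. s n x \<partial>lborel) \<longlonglongrightarrow> (\<integral>x. partial_deriv i F x \<partial>lborel)"
  proof (rule integral_dominated_convergence)
    \<comment> \<open>If \<open>norm x > R + 1\<close>, then \<open>x\<close> and its translate by a
      step of length at most 1 both lie outside \<open>K\<close>, so every difference quotient
      vanishes at \<open>x\<close>.\<close>
    show "integrable lborel (\<lambda>x. C * indicator (cball 0 (R + 1)) x)"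
      by (intro integrable_mult_right integrable_real_indicator)
        (use emeasure_bounded_finite[of "cball 0 (R + 1)"] in auto)
    show "AE x in lborel. (\<lambda>n. s n x) \<longlonglongrightarrow> partial_deriv i F x"
    proof (rule AE_I2)
      fix x
      have "(\<lambda>h. (F (x + (0 + h) *\<^sub>R ?e) - F (x + 0 *\<^sub>R ?e)) / h) \<midarrow>0\<rightarrow> partial_deriv i F x"
        using has_real_derivative_along_axis[OF diff, of x i 0] by (simp add: DERIV_def)
      moreover have "filterlim \<tau> (at 0) sequentially"
        unfolding filterlim_at using LIMSEQ_inverse_real_of_nat \<tau>(1)
        by (auto simp: \<tau>_def[abs_def] intro!: always_eventually)
      ultimately have "(\<lambda>n. (F (x + (0 + \<tau> n) *\<^sub>R ?e) - F (x + 0 *\<^sub>R ?e)) / \<tau> n) \<longlonglongrightarrow> partial_deriv i F x"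
        by (rule filterlim_compose)
      then show "(\<lambda>n. s n x) \<longlonglongrightarrow> partial_deriv i F x"
        by (simp add: s_def[abs_def] add.commute)
    qed
    show "AE x in lborel. norm (s n x) \<le> C * indicator (cball 0 (R + 1)) x" for n
    proof (rule AE_I2)
      fix x
      show "norm (s n x) \<le> C * indicator (cball 0 (R + 1)) x"
      proof (cases "x \<in> cball 0 (R + 1)")
        case True
        \<comment> \<open>By the mean value theorem the quotient is a value of the partial
          derivative, so \<open>C\<close> dominates it for every \<open>n\<close>.\<close>
        obtain z where "F (x + \<tau> n *\<^sub>R ?e) - F (x + 0 *\<^sub>R ?e)
            = (\<tau> n - 0) * partial_deriv i F (x + z *\<^sub>R ?e)"
          using MVT2[OF \<tau>(1)[of n] has_real_derivative_along_axis[OF diff, of x i]] by blast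
        then have "s n x = partial_deriv i F (x + z *\<^sub>R ?e)"
          using \<tau>(1)[of n] by (simp add: s_def add.commute)
        then show ?thesis using dC True by simp
      next
        case False
        then have x: "norm x > R + 1" by simp
        have "norm x \<le> norm (\<tau> n *\<^sub>R ?e + x) + norm (\<tau> n *\<^sub>R ?e)"
          by (metis norm_triangle_ineq4 add_diff_cancel_left')
        then have "norm (\<tau> n *\<^sub>R ?e + x) > R" using x \<tau>[of n] by (simp add: norm_axis_1)
        then have "F (\<tau> n *\<^sub>R ?e + x) = 0" "F x = 0" using R x supp by force+
        then show ?thesis using C(1) by (simp add: s_def)
      qed
    qed
  qed (simp_all add: s_def)
  then show ?thesis by (simp add: s0 LIMSEQ_const_iff)
qed

text \<open>The product is again a test function, so its partial derivative has integral zero over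
  the whole space; all integrands vanish outside \<Omega>, which restores the domain.\<close>

lemma integration_by_parts:
  assumes f: "f \<in> test_functions \<Omega>" and g: "g \<in> test_functions \<Omega>" and \<Omega>: "\<Omega> \<in> sets lebesgue"
  shows "(\<integral>x. f x * partial_deriv i g x \<partial>lebesgue_on \<Omega>)
    = - (\<integral>x. partial_deriv i f x * g x \<partial>lebesgue_on \<Omega>)"
proof -
  obtain K where K: "compact K" "K \<subseteq> \<Omega>" "\<And>x. x \<notin> K \<Longrightarrow> f x = 0"
    using f by (rule test_functionsE) blast
  have fg: "(\<lambda>x. f x * g x) \<in> test_functions \<Omega>"
    using f g by (intro test_functions_mult test_functions_Ck)
  have dfg: "partial_deriv i (\<lambda>x. f x * g x) = (\<lambda>x. f x * partial_deriv i g x + partial_deriv i f x * g x)"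
    using f g by (simp add: fun_eq_iff partial_deriv_mult test_functions_differentiable)
  have df0: "partial_deriv i f x = 0" if "x \<notin> K" for x
    using partial_deriv_outside_support[of K f x i] K that by (simp add: compact_imp_closed)
  have c1: "continuous_on UNIV (\<lambda>x. f x * partial_deriv i g x)"
    and c2: "continuous_on UNIV (\<lambda>x. partial_deriv i f x * g x)"
    using f g test_functions_continuous test_functions_continuous_partial_deriv
    by (intro continuous_on_mult; blast)+
  have i1: "integrable lborel (\<lambda>x. f x * partial_deriv i g x)"
    by (rule integrable_lborel_compact_support[OF c1 K(1)]) (simp add: K)
  have i2: "integrable lborel (\<lambda>x. partial_deriv i f x * g x)"
    by (rule integrable_lborel_compact_support[OF c2 K(1)]) (simp add: df0)
  have "(\<integral>x. partial_deriv i (\<lambda>x. f x * g x) x \<partial>lborel) = 0"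
    by (rule integral_partial_deriv_eq_0[OF test_functions_differentiable[OF fg]
          test_functions_continuous_partial_deriv[OF fg] K(1)]) (simp add: K(3))
  then have "(\<integral>x. f x * partial_deriv i g x + partial_deriv i f x * g x \<partial>lborel) = 0"
    by (simp add: dfg)
  then have "(\<integral>x. f x * partial_deriv i g x \<partial>lborel) = - (\<integral>x. partial_deriv i f x * g x \<partial>lborel)"
    using i1 i2 by simp
  moreover have "f x * partial_deriv i g x = 0" "partial_deriv i f x * g x = 0" if "x \<notin> \<Omega>" for x
    using K(2,3) df0 that by auto
  ultimately show ?thesis
    using integral_lebesgue_on_eq_lborel[OF c1 _ \<Omega>] integral_lebesgue_on_eq_lborel[OF c2 _ \<Omega>] by simp
qed

section \<open>The fundamental lemma of the calculus of variations\<close>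

text \<open>The family \<open>p(1/t) e\<^sup>-\<^sup>1\<^sup>/\<^sup>t\<close>, \<open>p\<close> a polynomial, is closed under differentiation.\<close>

definition bump :: "real poly \<Rightarrow> real \<Rightarrow> real" where
  "bump p t = (if 0 < t then poly p (1 / t) * exp (- (1 / t)) else 0)"

text \<open>With \<open>y = 1/t\<close> this gives differentiability of \<open>bump\<close> at
  0.\<close>

lemma poly_times_exp_minus_tendsto_0:
  fixes p :: "real poly"
  shows "((\<lambda>y. poly p y * exp (- y)) \<longlongrightarrow> 0) at_top"
proof -
  have "((\<lambda>y. \<Sum>i\<le>degree p. coeff p i * (y ^ i / exp y)) \<longlongrightarrow> (\<Sum>i\<le>degree p. coeff p i * 0)) at_top"
    by (intro tendsto_sum tendsto_mult tendsto_const tendsto_power_div_exp_0)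
  then show ?thesis
    by (simp add: poly_altdef sum_divide_distrib exp_minus flip: divide_inverse)
qed

text \<open>For positive \<open>t\<close> the derivative of \<open>p(1/t) exp(-1/t)\<close> is
  \<open>(1/t)^2 (p - p')(1/t) exp(-1/t)\<close>, and \<open>[:0, 0, 1:]\<close> is the square of
  the variable \<open>1/t\<close>.\<close>

lemma bump_has_real_derivative:
  "(bump p has_real_derivative bump ([:0, 0, 1:] * (p - pderiv p)) t) (at t)"
proof (cases t "0 :: real" rule: linorder_cases)
  case less
  have "(bump p has_real_derivative 0) (at t)"
    by (rule has_field_derivative_transform_within_open[OF DERIV_const, where S = "{..<0}"])
      (use less in \<open>auto simp: bump_def\<close>)
  with less show ?thesis by (simp add: bump_def)
next
  case greater
  have "((\<lambda>s. poly p (1 / s) * exp (- (1 / s))) has_real_derivative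
      bump ([:0, 0, 1:] * (p - pderiv p)) t) (at t)"
    using greater
    by (auto intro!: derivative_eq_intros poly_DERIV[THEN DERIV_chain2]
        simp: bump_def algebra_simps power2_eq_square divide_simps)
  then show ?thesis
    by (rule has_field_derivative_transform_within_open[where S = "{0<..}"])
      (use greater in \<open>auto simp: bump_def\<close>)
next
  case equal
  have "((\<lambda>h. bump p h / h) \<longlongrightarrow> 0) (at 0)"
  proof (rule filterlim_split_at)
    show "((\<lambda>h. bump p h / h) \<longlongrightarrow> 0) (at_left 0)"
      by (rule tendsto_eventually) (auto simp: eventually_at_filter bump_def)
    \<comment> \<open>Dividing by \<open>h\<close> adds one factor \<open>1/h\<close>, the variable
      of the polynomial; hence \<open>pCons 0 p\<close>.\<close>
    have "((\<lambda>h. poly (pCons 0 p) (inverse h) * exp (- inverse h)) \<longlongrightarrow> 0) (at_right 0)"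
      by (rule filterlim_compose[OF poly_times_exp_minus_tendsto_0 filterlim_inverse_at_top_right])
    then show "((\<lambda>h. bump p h / h) \<longlongrightarrow> 0) (at_right 0)"
      by (rule Lim_transform_eventually)
        (auto simp: eventually_at_filter bump_def field_simps)
  qed
  then show ?thesis using equal by (simp add: DERIV_def bump_def)
qed

text \<open>The induction leaves \<open>p\<close> arbitrary, since each partial derivative is a bump
  with another polynomial, times a constant.\<close>

lemma Ck_bump_affine: "Ck k (\<lambda>x::real^'n. bump p (c * x $ j + d))"
proof (induction k arbitrary: p)
  case 0
  have "continuous_on UNIV (bump p)"
    using bump_has_real_derivative DERIV_isCont by (blast intro: continuous_at_imp_continuous_on)
  then show ?case
    by (auto intro!: continuous_intros continuous_on_compose2[of UNIV "bump p"])
next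
  case (Suc k)
  let ?q = "[:0, 0, 1:] * (p - pderiv p)"
  have der: "((\<lambda>x::real^'n. bump p (c * x $ j + d)) has_derivative
      (\<lambda>h. bump ?q (c * x $ j + d) * (c * h $ j))) (at x)" for x
  proof -
    have "((\<lambda>x::real^'n. c * x $ j + d) has_derivative (\<lambda>h. c * h $ j)) (at x)"
      by (auto intro!: derivative_eq_intros bounded_linear_imp_has_derivative bounded_linear_vec_nth)
    from has_derivative_compose[OF this
        bump_has_real_derivative[of p "c * x $ j + d", unfolded has_field_derivative_def]]
    show ?thesis .
  qed
  have "partial_deriv i (\<lambda>x::real^'n. bump p (c * x $ j + d))
      = (\<lambda>x. bump ?q (c * x $ j + d) * (c * axis i 1 $ j))" for i
    by (rule ext) (rule partial_deriv_eq[OF der])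
  moreover have "Ck k (\<lambda>x::real^'n. bump ?q (c * x $ j + d) * (c * axis i 1 $ j))" for i
    by (intro Ck_mult Ck_const Suc.IH)
  moreover have "(\<lambda>x::real^'n. bump p (c * x $ j + d)) differentiable (at x)" for x
    using der by (auto simp: differentiable_def)
  ultimately show ?case by simp
qed

lemma bump_1_bounds: "0 \<le> bump 1 t" "bump 1 t \<le> 1"
  by (auto simp: bump_def)

text \<open>For positive \<open>t\<close>, \<open>bump 1 t\<close> is \<open>exp(-1/t)\<close> and
  scaling drives the exponent to 0. At \<open>t = 0\<close> the value stays 0, so the limit is the
  indicator of the open half-line.\<close>

lemma bump_1_scaled_tendsto:
  "(\<lambda>n. bump 1 (real n * t)) \<longlonglongrightarrow> (if 0 < t then 1 else 0)"
proof (cases "0 < t")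
  case True
  have "(\<lambda>n. exp (- (inverse (real n) / t))) \<longlonglongrightarrow> exp (- (0 / t))"
    using True by (intro tendsto_intros lim_inverse_n) auto
  then have "(\<lambda>n. exp (- (inverse (real n) / t))) \<longlonglongrightarrow> 1" by simp
  then have "(\<lambda>n. bump 1 (real n * t)) \<longlonglongrightarrow> 1"
  proof (rule Lim_transform_eventually)
    show "\<forall>\<^sub>F n in sequentially. exp (- (inverse (real n) / t)) = bump 1 (real n * t)"
      using eventually_gt_at_top[of "0::nat"]
      by eventually_elim (use True in \<open>simp add: bump_def field_simps\<close>)
  qed
  with True show ?thesis by simp
next
  case False
  then have "bump 1 (real n * t) = 0" for n by (simp add: bump_def zero_less_mult_iff)
  with False show ?thesis by simp
qed

text \<open>The functions vanish outside the closed box while their limit is the indicator of the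
  open one, because \<open>bump 1\<close> is 0 at 0. The faces in between form a null set.\<close>

lemma test_functions_approximate_box:
  fixes a b :: "real^'n"
  assumes "cbox a b \<subseteq> \<Omega>"
  obtains \<phi> where "\<And>n::nat. \<phi> n \<in> test_functions \<Omega>"
    and "\<And>n x. \<bar>\<phi> n x\<bar> \<le> indicator (cbox a b) x"
    and "\<And>x. (\<lambda>n. \<phi> n x) \<longlonglongrightarrow> indicator (box a b) x"
proof
  \<comment> \<open>Each coordinate contributes a factor that switches on at \<open>a $ j\<close>
    and one that switches off at \<open>b $ j\<close>. The arguments have the affine shape of
    \<open>Ck_bump_affine\<close>; \<open>eq\<close> is the readable form.\<close>
  define \<phi> where "\<phi> n x = (\<Prod>j\<in>UNIV. bump 1 (real n * x $ j + (- real n * a $ j))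
      * bump 1 (- real n * x $ j + real n * b $ j))" for n :: nat and x :: "real^'n"
  have eq: "\<phi> n x = (\<Prod>j\<in>UNIV. bump 1 (real n * (x $ j - a $ j)) * bump 1 (real n * (b $ j - x $ j)))"
    for n x by (simp add: \<phi>_def algebra_simps)
  have out: "\<phi> n x = 0" if "x \<notin> cbox a b" for n x
  proof -
    from that obtain j where "x $ j < a $ j \<or> b $ j < x $ j"
      by (auto simp: mem_box_cart not_le)
    then have "bump 1 (real n * (x $ j - a $ j)) * bump 1 (real n * (b $ j - x $ j)) = 0"
      by (auto simp: bump_def zero_less_mult_iff)
    then show ?thesis unfolding eq by (intro prod_zero) auto
  qed
  show "\<phi> n \<in> test_functions \<Omega>" for n
  proof (rule test_functionsI[where K = "cbox a b"])
    show "Ck k (\<phi> n)" for k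
      unfolding \<phi>_def by (intro Ck_prod Ck_mult Ck_bump_affine)
  qed (use assms out in auto)
  show "\<bar>\<phi> n x\<bar> \<le> indicator (cbox a b) x" for n x
  proof (cases "x \<in> cbox a b")
    case True
    have "0 \<le> \<phi> n x" unfolding eq by (intro prod_nonneg) (simp add: bump_1_bounds)
    moreover have "\<phi> n x \<le> 1"
      unfolding eq by (intro prod_le_1) (simp add: bump_1_bounds mult_le_one)
    ultimately show ?thesis using True by simp
  qed (simp add: out)
  show "(\<lambda>n. \<phi> n x) \<longlonglongrightarrow> indicator (box a b) x" for x
  proof -
    have "(\<lambda>n. \<phi> n x) \<longlonglongrightarrow> (\<Prod>j\<in>UNIV. (if 0 < x $ j - a $ j then 1 else 0)
        * (if 0 < b $ j - x $ j then 1 else 0))"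
      unfolding eq by (intro tendsto_prod tendsto_mult bump_1_scaled_tendsto)
    also have "(\<Prod>j\<in>UNIV. (if 0 < x $ j - a $ j then 1 else 0) * (if 0 < b $ j - x $ j then 1 else 0))
        = (indicator (box a b) x :: real)"
    proof (cases "x \<in> box a b")
      case False
      then obtain j where "\<not> (0 < x $ j - a $ j \<and> 0 < b $ j - x $ j)"
        by (auto simp: mem_box_cart)
      then have "(\<Prod>j\<in>UNIV. (if 0 < x $ j - a $ j then 1 else 0) * (if 0 < b $ j - x $ j then 1 else (0::real))) = 0"
        by (intro prod_zero) auto
      with False show ?thesis by simp
    qed (auto simp: mem_box_cart intro!: prod.neutral)
    finally show ?thesis .
  qed
qed

text \<open>Dynkin's argument: open boxes are stable under intersection and generate the Borel sets,
  so the integral of \<open>g\<close> vanishes over every Borel set, and \<open>g\<close> agrees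
  with the zero density.\<close>

lemma AE_eq_0_if_box_integrals_eq_0:
  fixes g :: "'a::euclidean_space \<Rightarrow> real"
  assumes g: "integrable lborel g" and box0: "\<And>a b. (LINT x:box a b|lborel. g x) = 0"
  shows "AE x in lborel. g x = 0"
proof -
  have si: "set_integrable lborel A g" if "A \<in> sets lborel" for A
    unfolding set_integrable_def using that g by (rule integrable_mult_indicator)
  \<comment> \<open>The complement step needs the integral over the whole space, obtained as a limit
    over growing boxes.\<close>
  have tot: "(\<integral>x. g x \<partial>lborel) = 0"
  proof -
    let ?B = "\<lambda>n::nat. box (- (real n *\<^sub>R One)) (real n *\<^sub>R One) :: 'a set"
    have U: "(\<Union>n. ?B n) = UNIV" by (rule UN_box_eq_UNIV)
    have "(\<lambda>n. LINT x:?B n|lborel. g x) \<longlonglongrightarrow> (LINT x:(\<Union>n. ?B n)|lborel. g x)"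
    proof (rule set_integral_cont_up)
      show "incseq ?B"
        by (auto simp: incseq_def box_def)
    qed (auto intro: si)
    then have "(LINT x:UNIV|lborel. g x) = 0"
      unfolding U box0 by (simp only: LIMSEQ_const_iff)
    then show ?thesis by (simp add: set_lebesgue_integral_def)
  qed
  have "(LINT x:A|lborel. g x) = 0" if "A \<in> sets borel" for A
  proof -
    have "Int_stable (range (\<lambda>(a, b). box a b :: 'a set))"
      by (auto simp: Int_stable_def box_Int_box)
    moreover have "range (\<lambda>(a, b). box a b :: 'a set) \<subseteq> Pow UNIV" by auto
    moreover have "A \<in> sigma_sets UNIV (range (\<lambda>(a, b). box a b))"
      using that by (simp add: borel_eq_box)
    ultimately show ?thesis
    proof (induction rule: sigma_sets_induct_disjoint)
      case (basic A)
      then show ?case using box0 by auto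
    next
      case empty
      show ?case by (simp add: set_lebesgue_integral_def)
    next
      case (compl A)
      then have A: "A \<in> sets lborel" by (simp add: borel_eq_box)
      have "(LINT x:A \<union> (UNIV - A)|lborel. g x)
          = (LINT x:A|lborel. g x) + (LINT x:UNIV - A|lborel. g x)"
        by (rule set_integral_Un) (use A in \<open>auto intro!: si\<close>)
      with compl tot show ?case by (simp add: set_lebesgue_integral_def)
    next
      case (union A)
      then have A: "A i \<in> sets lborel" for i by (auto simp: borel_eq_box)
      have "(LINT x:(\<Union>i. A i)|lborel. g x) = (\<Sum>i. LINT x:A i|lborel. g x)"
        by (rule lebesgue_integral_countable_add)
          (use A union(1) in \<open>auto intro!: si simp: disjoint_family_on_def\<close>)
      with union show ?case by simp
    qed
  qed
  then show ?thesis
    using g by (intro density_unique_real) (auto simp: set_lebesgue_integral_def)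
qed

text \<open>Bounded pointwise limits of test functions reach the indicators of open boxes whose
  closed box lies in \<Omega>. So \<open>g\<close> is shown to vanish on each closed box inside
  \<Omega>, and countably many of these cover \<Omega>.\<close>

lemma fundamental_lemma:
  fixes g :: "real^'n \<Rightarrow> real"
  assumes \<Omega>: "open \<Omega>" and g: "g \<in> L2 \<Omega>"
    and test: "\<And>\<phi>. \<phi> \<in> test_functions \<Omega> \<Longrightarrow> (\<integral>x. g x * \<phi> x \<partial>lebesgue_on \<Omega>) = 0"
  shows "AE x in lebesgue_on \<Omega>. g x = 0"
proof -
  have \<Omega>m[measurable]: "\<Omega> \<in> sets lebesgue"
    using borel_open[OF \<Omega>] by (simp add: sets_completionI_sets)
  have gm[measurable]: "g \<in> borel_measurable (lebesgue_on \<Omega>)" using g by (rule L2_measurable)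
  \<comment> \<open>On an \<Omega> of infinite measure \<open>g\<close> may fail to be integrable;
    paired with the square-integrable indicator of a bounded box it is.\<close>
  have gint: "integrable (lebesgue_on \<Omega>) (\<lambda>x. g x * indicator (cbox a b) x)" for a b
  proof -
    have "integrable lborel (indicator (cbox a b) :: real^'n \<Rightarrow> real)"
      using emeasure_bounded_finite[of "cbox a b"] by (auto intro!: integrable_real_indicator)
    then have "integrable lebesgue (indicator (cbox a b) :: real^'n \<Rightarrow> real)"
      by (simp add: integrable_completion)
    then have "integrable (lebesgue_on \<Omega>) (indicator (cbox a b) :: real^'n \<Rightarrow> real)"
      using integrable_mult_indicator[of \<Omega> lebesgue "indicator (cbox a b) :: real^'n \<Rightarrow> real"]
      by (simp add: integrable_restrict_space)
    moreover have "(\<lambda>x. (norm (indicator (cbox a b) x :: real))\<^sup>2) = (indicator (cbox a b) :: real^'n \<Rightarrow> real)"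
      by (auto simp: indicator_def)
    ultimately have "(indicator (cbox a b) :: real^'n \<Rightarrow> real) \<in> L2 \<Omega>"
      by (simp add: L2_def)
    from L2_inner_integrable[OF g this] show ?thesis by simp
  qed
  have box0: "(\<integral>x. g x * indicator (box a b) x \<partial>lebesgue_on \<Omega>) = 0" if ab: "cbox a b \<subseteq> \<Omega>" for a b
  proof -
    obtain \<phi> where \<phi>: "\<And>n::nat. \<phi> n \<in> test_functions \<Omega>"
      "\<And>n x. \<bar>\<phi> n x\<bar> \<le> indicator (cbox a b) x"
      "\<And>x. (\<lambda>n. \<phi> n x) \<longlonglongrightarrow> indicator (box a b) x"
      using test_functions_approximate_box[OF ab] by blast
    have [measurable]: "\<phi> n \<in> borel_measurable (lebesgue_on \<Omega>)" for n
      using \<phi>(1) test_functions_continuous continuous_measurable_lebesgue_on by blast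
    have "(\<lambda>n. \<integral>x. g x * \<phi> n x \<partial>lebesgue_on \<Omega>) \<longlonglongrightarrow> (\<integral>x. g x * indicator (box a b) x \<partial>lebesgue_on \<Omega>)"
    proof (rule integral_dominated_convergence)
      show "integrable (lebesgue_on \<Omega>) (\<lambda>x. norm (g x * indicator (cbox a b) x))"
        using gint by (rule integrable_norm)
      show "AE x in lebesgue_on \<Omega>. norm (g x * \<phi> n x) \<le> norm (g x * indicator (cbox a b) x)" for n
        using \<phi>(2) by (auto simp: abs_mult intro!: AE_I2 mult_left_mono)
      show "(\<lambda>x. g x * indicator (box a b) x) \<in> borel_measurable (lebesgue_on \<Omega>)"
        by (intro borel_measurable_times gm measurable_restrict_space1 measurable_completion) measurable
    qed (auto intro!: AE_I2 tendsto_intros \<phi>(3))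
    then show ?thesis by (simp add: test[OF \<phi>(1)] LIMSEQ_const_iff)
  qed
  have on_box: "AE x in lebesgue. x \<in> cbox u v \<longrightarrow> g x = 0" if uv: "cbox u v \<subseteq> \<Omega>" for u v
  proof -
    let ?h = "\<lambda>x. indicator \<Omega> x *\<^sub>R (g x * indicator (box u v) x)"
    have "integrable (lebesgue_on \<Omega>) (\<lambda>x. g x * indicator (box u v) x)"
    proof (rule Bochner_Integration.integrable_bound[OF gint[of u v]])
      show "(\<lambda>x. g x * indicator (box u v) x) \<in> borel_measurable (lebesgue_on \<Omega>)"
        by (intro borel_measurable_times gm measurable_restrict_space1 measurable_completion) measurable
      show "AE x in lebesgue_on \<Omega>. norm (g x * indicator (box u v) x) \<le> norm (g x * indicator (cbox u v) x)"
        using box_subset_cbox[of u v] by (auto simp: indicator_def intro!: AE_I2)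
    qed
    then have hint: "integrable lebesgue ?h" by (simp add: integrable_restrict_space)
    \<comment> \<open>\<open>g\<close> is only Lebesgue measurable, while the box criterion is about
      \<open>lborel\<close>; a Borel function equal almost everywhere takes its place.\<close>
    obtain h' where h'm[measurable]: "h' \<in> borel_measurable lborel" and h': "AE x in lborel. ?h x = h' x"
      using completion_ex_borel_measurable_real[of ?h lborel] hint by blast
    have h'l: "AE x in lebesgue. ?h x = h' x" using h' by (rule AE_completion)
    have "integrable lebesgue h'"
      by (rule integrable_cong_AE_imp[OF hint]) (use h'm h'l in \<open>auto intro: measurable_completion\<close>)
    then have h'int: "integrable lborel h'" by (simp add: integrable_completion)
    have "AE x in lborel. h' x = 0"
    proof (rule AE_eq_0_if_box_integrals_eq_0[OF h'int])
      fix a b :: "real^'n"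
      obtain a' b' where ab': "box a b \<inter> box u v = box a' b'"
        using box_Int_box[of a b u v] by blast
      have "(LINT x:box a b|lborel. h' x) = (\<integral>x. indicator (box a b) x *\<^sub>R h' x \<partial>lebesgue)"
        unfolding set_lebesgue_integral_def by (rule integral_completion[symmetric]) measurable
      also have "\<dots> = (\<integral>x. indicator (box a b) x *\<^sub>R ?h x \<partial>lebesgue)"
      proof (rule integral_cong_AE)
        show "AE x in lebesgue. indicator (box a b) x *\<^sub>R h' x = indicator (box a b) x *\<^sub>R ?h x"
          using h'l by eventually_elim simp
        show "(\<lambda>x. indicator (box a b) x *\<^sub>R h' x) \<in> borel_measurable lebesgue"
          by (intro measurable_completion) measurable
        show "(\<lambda>x. indicator (box a b) x *\<^sub>R ?h x) \<in> borel_measurable lebesgue"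
          using hint by (intro borel_measurable_scaleR borel_measurable_integrable
              borel_measurable_indicator) auto
      qed
      also have "\<dots> = (\<integral>x. indicator \<Omega> x *\<^sub>R (g x * indicator (box a' b') x) \<partial>lebesgue)"
        by (intro Bochner_Integration.integral_cong) (auto simp: indicator_def simp flip: ab')
      also have "\<dots> = (\<integral>x. g x * indicator (box a' b') x \<partial>lebesgue_on \<Omega>)"
        by (simp add: integral_restrict_space)
      also have "\<dots> = 0"
      \<comment> \<open>\<open>box0\<close> requires \<open>cbox a' b'\<close> inside \<Omega>. For
        a nonempty open box this is its closure and stays in \<open>cbox u v\<close>; for an empty
        one the corners may lie anywhere, but the integral is trivially 0.\<close>
      proof (cases "box a' b' = {}")
        case False
        then have "cbox a' b' = closure (box a' b')" by (simp add: closure_box)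
        also have "\<dots> \<subseteq> cbox u v"
          using ab' box_subset_cbox[of u v] by (intro closure_minimal) auto
        finally show ?thesis using uv by (intro box0) auto
      qed simp
      finally show "(LINT x:box a b|lborel. h' x) = 0" .
    qed
    then have "AE x in lebesgue. h' x = 0" by (rule AE_completion)
    \<comment> \<open>\<open>?h\<close> carries the indicator of the open box, so the faces of the
      closed box are discarded as a null set.\<close>
    moreover have "AE x in lebesgue. x \<notin> cbox u v - box u v"
      using negligible_frontier_interval[of u v] by (intro AE_not_in) (simp add: negligible_iff_null_sets)
    ultimately show ?thesis using h'l
    proof eventually_elim
      case (elim x)
      then show ?case using uv by (auto simp: indicator_def split: if_splits)
    qed
  qed
  obtain \<D> where \<D>: "countable \<D>" "\<D> \<subseteq> Pow \<Omega>" "\<And>X. X \<in> \<D> \<Longrightarrow> \<exists>a b. X = cbox a b" "\<Union>\<D> = \<Omega>"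
    using open_countable_Union_open_cbox[OF \<Omega>] by metis
  have "AE x in lebesgue. x \<in> X \<longrightarrow> g x = 0" if "X \<in> \<D>" for X
    using \<D>(2) \<D>(3)[OF that] that on_box by auto
  then have "AE x in lebesgue. \<forall>X\<in>\<D>. x \<in> X \<longrightarrow> g x = 0"
    unfolding AE_ball_countable[OF \<D>(1)] by blast
  then have "AE x in lebesgue. x \<in> \<Omega> \<longrightarrow> g x = 0"
    by eventually_elim (use \<D>(4) in auto)
  then show ?thesis by (simp add: AE_restrict_space_iff)
qed

section \<open>Weak gradients and \<open>H\<^sub>0\<^sup>1\<close>\<close>

lemma open_in_sets_lebesgue: "open \<Omega> \<Longrightarrow> \<Omega> \<in> sets lebesgue"
  using borel_open by (simp add: sets_completionI_sets)

lemma test_functions_L2: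
  assumes "open \<Omega>" "\<phi> \<in> test_functions \<Omega>"
  shows "\<phi> \<in> L2 \<Omega>" "partial_deriv i \<phi> \<in> L2 \<Omega>" "gradient \<phi> \<in> L2 \<Omega>"
proof -
  obtain K where K: "compact K" "\<And>x. x \<notin> K \<Longrightarrow> \<phi> x = 0"
    using assms(2) by (rule test_functionsE) blast
  have d0: "partial_deriv i \<phi> x = 0" if "x \<notin> K" for i x
    using partial_deriv_outside_support[of K \<phi> x i] K that by (simp add: compact_imp_closed)
  have cont: "continuous_on UNIV (gradient \<phi>)"
    unfolding gradient_def
    by (intro continuous_on_vec_lambda test_functions_continuous_partial_deriv[OF assms(2)])
  have \<Omega>: "\<Omega> \<in> sets lebesgue" using assms(1) by (rule open_in_sets_lebesgue)
  show "\<phi> \<in> L2 \<Omega>"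
    using test_functions_continuous[OF assms(2)] K \<Omega> by (rule L2_compact_support)
  show "partial_deriv i \<phi> \<in> L2 \<Omega>"
    using test_functions_continuous_partial_deriv[OF assms(2)] K(1) d0 \<Omega>
    by (rule L2_compact_support)
  show "gradient \<phi> \<in> L2 \<Omega>"
    by (rule L2_compact_support[OF cont K(1) _ \<Omega>]) (simp add: gradient_def vec_eq_iff d0)
qed

lemma L2_component:
  fixes G :: "real^'n \<Rightarrow> real^'m"
  assumes "G \<in> L2 \<Omega>"
  shows "(\<lambda>x. G x $ i) \<in> L2 \<Omega>"
proof (rule L2_dominated[OF _ assms, where c = 1])
  have "(\<lambda>x. G x \<bullet> axis i 1) \<in> borel_measurable (lebesgue_on \<Omega>)"
    using L2_measurable[OF assms] by measurable
  then show "(\<lambda>x. G x $ i) \<in> borel_measurable (lebesgue_on \<Omega>)" by (simp add: inner_axis)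
qed (simp add: component_le_norm_cart)

section \<open>Linearity and uniqueness of weak gradients\<close>

lemma L2_inner_real: "L2_inner \<Omega> f g = (\<integral>x. f x * g x \<partial>lebesgue_on \<Omega>)" for f g :: "_ \<Rightarrow> real"
  by (simp add: L2_inner_def)

text \<open>Written with \<open>L2_inner\<close>, linearity of weak gradients is bilinearity of the
  inner product.\<close>

lemma is_weak_gradient_iff:
  "is_weak_gradient \<Omega> \<psi> G \<longleftrightarrow> (\<forall>\<phi>\<in>test_functions \<Omega>. \<forall>i.
     L2_inner \<Omega> \<psi> (partial_deriv i \<phi>) = - L2_inner \<Omega> (\<lambda>x. G x $ i) \<phi>)"
  by (simp add: is_weak_gradient_def L2_inner_real)

lemma is_weak_gradient_add:
  assumes \<Omega>: "open \<Omega>" and "f \<in> L2 \<Omega>" "g \<in> L2 \<Omega>" "F \<in> L2 \<Omega>" "G \<in> L2 \<Omega>"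
    and "is_weak_gradient \<Omega> f F" "is_weak_gradient \<Omega> g G"
  shows "is_weak_gradient \<Omega> (\<lambda>x. f x + g x) (\<lambda>x. F x + G x)"
  using assms
  by (simp add: is_weak_gradient_iff L2_inner_add_left test_functions_L2[OF \<Omega>] L2_component)

lemma is_weak_gradient_cmult:
  assumes "is_weak_gradient \<Omega> f F"
  shows "is_weak_gradient \<Omega> (\<lambda>x. c * f x) (\<lambda>x. c *\<^sub>R F x)"
  using assms by (simp add: is_weak_gradient_iff L2_inner_scale_left[where 'b = real, simplified])

lemma is_weak_gradient_gradient:
  assumes "open \<Omega>" "\<phi> \<in> test_functions \<Omega>"
  shows "is_weak_gradient \<Omega> \<phi> (gradient \<phi>)"
  using integration_by_parts[OF assms(2) _ open_in_sets_lebesgue[OF assms(1)]]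
  by (simp add: is_weak_gradient_def gradient_def)

lemma is_weak_gradient_zero: "is_weak_gradient \<Omega> (\<lambda>x. 0) (\<lambda>x. 0)"
  by (simp add: is_weak_gradient_def)

lemma is_weak_gradient_unique:
  assumes \<Omega>: "open \<Omega>" and L: "G \<in> L2 \<Omega>" "H \<in> L2 \<Omega>"
    and w: "is_weak_gradient \<Omega> \<psi> G" "is_weak_gradient \<Omega> \<psi> H"
  shows "AE x in lebesgue_on \<Omega>. G x = H x"
proof -
  have "AE x in lebesgue_on \<Omega>. G x $ i - H x $ i = 0" for i
  proof (rule fundamental_lemma[OF \<Omega>])
    show "(\<lambda>x. G x $ i - H x $ i) \<in> L2 \<Omega>" using L by (intro L2_diff L2_component)
    fix \<phi> assume \<phi>: "\<phi> \<in> test_functions \<Omega>"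
    have "L2_inner \<Omega> (\<lambda>x. G x $ i - H x $ i) \<phi> = L2_inner \<Omega> (\<lambda>x. G x $ i) \<phi> - L2_inner \<Omega> (\<lambda>x. H x $ i) \<phi>"
      using L test_functions_L2(1)[OF \<Omega> \<phi>] by (intro L2_inner_diff_left L2_component)
    also have "\<dots> = 0" using w \<phi> by (simp add: is_weak_gradient_iff)
    finally show "(\<integral>x. (G x $ i - H x $ i) * \<phi> x \<partial>lebesgue_on \<Omega>) = 0"
      by (simp only: L2_inner_real)
  qed
  then have "AE x in lebesgue_on \<Omega>. \<forall>i\<in>UNIV. G x $ i - H x $ i = 0"
    by (intro AE_finite_allI) auto
  then show ?thesis by eventually_elim (simp add: vec_eq_iff)
qed

lemma weak_gradient_someI:
  assumes "G \<in> L2 \<Omega>" "is_weak_gradient \<Omega> \<psi> G"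
  shows "weak_gradient \<Omega> \<psi> \<in> L2 \<Omega>" "is_weak_gradient \<Omega> \<psi> (weak_gradient \<Omega> \<psi>)"
  using someI[of "\<lambda>G. G \<in> L2 \<Omega> \<and> is_weak_gradient \<Omega> \<psi> G" G] assms
  by (auto simp: weak_gradient_def)

lemma weak_gradient_AE_eq:
  assumes "open \<Omega>" "G \<in> L2 \<Omega>" "is_weak_gradient \<Omega> \<psi> G"
  shows "AE x in lebesgue_on \<Omega>. weak_gradient \<Omega> \<psi> x = G x"
  using assms weak_gradient_someI[OF assms(2,3)] by (blast intro: is_weak_gradient_unique)

lemma H1_weak_gradient:
  assumes "\<psi> \<in> H1 \<Omega>"
  shows "\<psi> \<in> L2 \<Omega>" "weak_gradient \<Omega> \<psi> \<in> L2 \<Omega>" "is_weak_gradient \<Omega> \<psi> (weak_gradient \<Omega> \<psi>)"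
  using assms weak_gradient_someI by (auto simp: H1_def)

lemma H1I: "\<psi> \<in> L2 \<Omega> \<Longrightarrow> G \<in> L2 \<Omega> \<Longrightarrow> is_weak_gradient \<Omega> \<psi> G \<Longrightarrow> \<psi> \<in> H1 \<Omega>"
  by (auto simp: H1_def)

text \<open>Both functions have the same set of weak gradients, so the choice in
  \<open>weak_gradient\<close> returns literally the same function for both. This makes the flux
  norm well defined on classes.\<close>

lemma is_weak_gradient_cong_AE:
  assumes \<Omega>: "open \<Omega>" and "f \<in> L2 \<Omega>" "g \<in> L2 \<Omega>" "AE x in lebesgue_on \<Omega>. f x = g x"
  shows "is_weak_gradient \<Omega> f = is_weak_gradient \<Omega> g"
  using L2_inner_cong_AE[OF assms(2,3) test_functions_L2(2)[OF \<Omega>] assms(4)]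
  by (simp add: is_weak_gradient_iff fun_eq_iff)

text \<open>\<open>H1_norm\<close> involves the gradient chosen for the difference, which has no
  literal relation to the one chosen for \<psi>. By uniqueness it agrees almost everywhere with
  \<open>gradient \<phi> - G\<close>, for any weak gradient \<open>G\<close> of \<psi>.\<close>

lemma H1_norm_diff_test_function:
  assumes \<Omega>: "open \<Omega>" and \<phi>: "\<phi> \<in> test_functions \<Omega>"
    and L: "\<psi> \<in> L2 \<Omega>" "G \<in> L2 \<Omega>" and w: "is_weak_gradient \<Omega> \<psi> G"
  shows "H1_norm \<Omega> (\<lambda>x. \<phi> x - \<psi> x)
    = sqrt ((L2_norm \<Omega> (\<lambda>x. \<phi> x - \<psi> x))\<^sup>2 + (L2_norm \<Omega> (\<lambda>x. gradient \<phi> x - G x))\<^sup>2)"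
proof -
  note \<phi>L = test_functions_L2[OF \<Omega> \<phi>]
  have D: "(\<lambda>x. gradient \<phi> x - G x) \<in> L2 \<Omega>" using \<phi>L(3) L(2) by (rule L2_diff)
  have "is_weak_gradient \<Omega> (\<lambda>x. \<phi> x + - 1 * \<psi> x) (\<lambda>x. gradient \<phi> x + - 1 *\<^sub>R G x)"
    by (intro is_weak_gradient_add is_weak_gradient_gradient is_weak_gradient_cmult \<Omega> \<phi> w
        \<phi>L(1,3) L2_scale[OF L(1), of "-1", simplified] L2_scale[OF L(2)])
      (use L2_scale[OF L(1), of "-1"] in simp)
  then have wd: "is_weak_gradient \<Omega> (\<lambda>x. \<phi> x - \<psi> x) (\<lambda>x. gradient \<phi> x - G x)" by simp
  have "L2_norm \<Omega> (weak_gradient \<Omega> (\<lambda>x. \<phi> x - \<psi> x)) = L2_norm \<Omega> (\<lambda>x. gradient \<phi> x - G x)"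
    using weak_gradient_someI(1)[OF D wd] D weak_gradient_AE_eq[OF \<Omega> D wd]
    by (rule L2_norm_cong_AE)
  then show ?thesis by (simp add: H1_norm_def)
qed

lemma H10E:
  assumes \<Omega>: "open \<Omega>" and \<psi>: "\<psi> \<in> H10 \<Omega>"
  obtains \<phi> where "\<And>n::nat. \<phi> n \<in> test_functions \<Omega>"
    and "(\<lambda>n. L2_norm \<Omega> (\<lambda>x. \<phi> n x - \<psi> x)) \<longlonglongrightarrow> 0"
    and "(\<lambda>n. L2_norm \<Omega> (\<lambda>x. gradient (\<phi> n) x - weak_gradient \<Omega> \<psi> x)) \<longlonglongrightarrow> 0"
proof -
  from \<psi> obtain \<phi> where H1: "\<psi> \<in> H1 \<Omega>" and \<phi>: "\<And>n::nat. \<phi> n \<in> test_functions \<Omega>"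
    and lim: "(\<lambda>n. H1_norm \<Omega> (\<lambda>x. \<phi> n x - \<psi> x)) \<longlonglongrightarrow> 0"
    unfolding H10_def by blast
  note eq = H1_norm_diff_test_function[OF \<Omega> \<phi> H1_weak_gradient[OF H1]]
  show ?thesis
  proof (rule that[OF \<phi>])
    show "(\<lambda>n. L2_norm \<Omega> (\<lambda>x. \<phi> n x - \<psi> x)) \<longlonglongrightarrow> 0"
      by (rule Lim_null_comparison[OF _ lim]) (simp add: eq)
    show "(\<lambda>n. L2_norm \<Omega> (\<lambda>x. gradient (\<phi> n) x - weak_gradient \<Omega> \<psi> x)) \<longlonglongrightarrow> 0"
      by (rule Lim_null_comparison[OF _ lim]) (simp add: eq)
  qed
qed

text \<open>\<open>G\<close> may be any square-integrable weak gradient; sums and multiples of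
  chosen gradients qualify without being the chosen gradient of the result.\<close>

lemma H10I:
  assumes \<Omega>: "open \<Omega>" and L: "\<psi> \<in> L2 \<Omega>" "G \<in> L2 \<Omega>" and w: "is_weak_gradient \<Omega> \<psi> G"
    and \<phi>: "\<And>n::nat. \<phi> n \<in> test_functions \<Omega>"
    and lim: "(\<lambda>n. L2_norm \<Omega> (\<lambda>x. \<phi> n x - \<psi> x)) \<longlonglongrightarrow> 0"
      "(\<lambda>n. L2_norm \<Omega> (\<lambda>x. gradient (\<phi> n) x - G x)) \<longlonglongrightarrow> 0"
  shows "\<psi> \<in> H10 \<Omega>"
proof -
  have "(\<lambda>n. H1_norm \<Omega> (\<lambda>x. \<phi> n x - \<psi> x)) \<longlonglongrightarrow> sqrt (0\<^sup>2 + 0\<^sup>2)"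
    unfolding H1_norm_diff_test_function[OF \<Omega> \<phi> L w] by (intro tendsto_intros lim)
  then show ?thesis using H1I[OF L w] \<phi> by (auto simp: H10_def)
qed

section \<open>Vector space structure of \<open>H10\<close>\<close>

lemma H10_imp_H1: "\<psi> \<in> H10 \<Omega> \<Longrightarrow> \<psi> \<in> H1 \<Omega>"
  by (simp add: H10_def)

lemma H10_zero: "open \<Omega> \<Longrightarrow> (\<lambda>x. 0) \<in> H10 \<Omega>"
  by (rule H10I[where \<phi> = "\<lambda>n x. 0", OF _ L2_zero L2_zero is_weak_gradient_zero test_functions_zero])
    (simp_all add: gradient_zero)

lemma H10_add:
  assumes \<Omega>: "open \<Omega>" and f: "f \<in> H10 \<Omega>" and g: "g \<in> H10 \<Omega>"
  shows "(\<lambda>x. f x + g x) \<in> H10 \<Omega>"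
proof -
  note F = H1_weak_gradient[OF H10_imp_H1[OF f]] and G = H1_weak_gradient[OF H10_imp_H1[OF g]]
  obtain \<phi> where \<phi>: "\<And>n::nat. \<phi> n \<in> test_functions \<Omega>"
    "(\<lambda>n. L2_norm \<Omega> (\<lambda>x. \<phi> n x - f x)) \<longlonglongrightarrow> 0"
    "(\<lambda>n. L2_norm \<Omega> (\<lambda>x. gradient (\<phi> n) x - weak_gradient \<Omega> f x)) \<longlonglongrightarrow> 0"
    using H10E[OF \<Omega> f] by blast
  obtain \<eta> where \<eta>: "\<And>n::nat. \<eta> n \<in> test_functions \<Omega>"
    "(\<lambda>n. L2_norm \<Omega> (\<lambda>x. \<eta> n x - g x)) \<longlonglongrightarrow> 0"
    "(\<lambda>n. L2_norm \<Omega> (\<lambda>x. gradient (\<eta> n) x - weak_gradient \<Omega> g x)) \<longlonglongrightarrow> 0"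
    using H10E[OF \<Omega> g] by blast
  show ?thesis
  proof (rule H10I[OF \<Omega>, where \<phi> = "\<lambda>n x. \<phi> n x + \<eta> n x"
        and G = "\<lambda>x. weak_gradient \<Omega> f x + weak_gradient \<Omega> g x"])
    show "(\<lambda>n. L2_norm \<Omega> (\<lambda>x. \<phi> n x + \<eta> n x - (f x + g x))) \<longlonglongrightarrow> 0"
      using \<phi> \<eta> F(1) G(1) test_functions_L2(1)[OF \<Omega>] by (intro L2_norm_add_tendsto_0) auto
    show "(\<lambda>n. L2_norm \<Omega> (\<lambda>x. gradient (\<lambda>x. \<phi> n x + \<eta> n x) x
        - (weak_gradient \<Omega> f x + weak_gradient \<Omega> g x))) \<longlonglongrightarrow> 0"
      unfolding gradient_add[OF \<phi>(1) \<eta>(1)]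
      using \<phi> \<eta> F(2) G(2) test_functions_L2(3)[OF \<Omega>] by (intro L2_norm_add_tendsto_0) auto
  qed (use F G \<phi>(1) \<eta>(1) \<Omega> in \<open>auto intro: L2_add is_weak_gradient_add test_functions_add\<close>)
qed

lemma H10_cmult:
  assumes \<Omega>: "open \<Omega>" and f: "f \<in> H10 \<Omega>"
  shows "(\<lambda>x. c * f x) \<in> H10 \<Omega>"
proof -
  note F = H1_weak_gradient[OF H10_imp_H1[OF f]]
  obtain \<phi> where \<phi>: "\<And>n::nat. \<phi> n \<in> test_functions \<Omega>"
    "(\<lambda>n. L2_norm \<Omega> (\<lambda>x. \<phi> n x - f x)) \<longlonglongrightarrow> 0"
    "(\<lambda>n. L2_norm \<Omega> (\<lambda>x. gradient (\<phi> n) x - weak_gradient \<Omega> f x)) \<longlonglongrightarrow> 0"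
    using H10E[OF \<Omega> f] by blast
  show ?thesis
  proof (rule H10I[OF \<Omega>, where \<phi> = "\<lambda>n x. c * \<phi> n x" and G = "\<lambda>x. c *\<^sub>R weak_gradient \<Omega> f x"])
    show "(\<lambda>n. L2_norm \<Omega> (\<lambda>x. c * \<phi> n x - c * f x)) \<longlonglongrightarrow> 0"
      using L2_norm_scale_tendsto_0[OF \<phi>(2), of c] by simp
    show "(\<lambda>n. L2_norm \<Omega> (\<lambda>x. gradient (\<lambda>x. c * \<phi> n x) x - c *\<^sub>R weak_gradient \<Omega> f x)) \<longlonglongrightarrow> 0"
      unfolding gradient_cmult[OF \<phi>(1)] using \<phi>(3) by (rule L2_norm_scale_tendsto_0)
    show "(\<lambda>x. c * f x) \<in> L2 \<Omega>" using L2_scale[OF F(1), of c] by simp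
  qed (use F \<phi>(1) in \<open>auto intro: L2_scale is_weak_gradient_cmult test_functions_cmult\<close>)
qed

section \<open>Potential fields\<close>

lemma closed_L2_subspace_potential_fields:
  assumes \<Omega>: "open \<Omega>"
  shows "closed_L2_subspace \<Omega> (potential_fields \<Omega>)"
  unfolding potential_fields_def
proof (rule closed_L2_subspace_closure)
  show "gradient ` test_functions \<Omega> \<subseteq> L2 \<Omega>" using test_functions_L2(3)[OF \<Omega>] by blast
  show "(\<lambda>x. 0) \<in> gradient ` test_functions \<Omega>"
    by (rule image_eqI[where x = "\<lambda>x. 0"]) (simp_all add: gradient_zero test_functions_zero)
  show "(\<lambda>x. F x + G x) \<in> gradient ` test_functions \<Omega>"
    if "F \<in> gradient ` test_functions \<Omega>" "G \<in> gradient ` test_functions \<Omega>" for F G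
  proof -
    from that obtain f g where "f \<in> test_functions \<Omega>" "F = gradient f"
      "g \<in> test_functions \<Omega>" "G = gradient g" by blast
    then show ?thesis
      by (intro image_eqI[of _ _ "\<lambda>x. f x + g x"]) (simp_all add: gradient_add test_functions_add)
  qed
  show "(\<lambda>x. c *\<^sub>R F x) \<in> gradient ` test_functions \<Omega>"
    if "F \<in> gradient ` test_functions \<Omega>" for c F
  proof -
    from that obtain f where "f \<in> test_functions \<Omega>" "F = gradient f" by blast
    then show ?thesis
      by (intro image_eqI[of _ _ "\<lambda>x. c * f x"]) (simp_all add: gradient_cmult test_functions_cmult)
  qed
qed

text \<open>Convergence in \<open>H1_norm\<close> includes convergence of the gradients. This is
  where membership in \<open>H10\<close> rather than \<open>H1\<close> enters the lower bound of the
  flux norm.\<close>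

lemma weak_gradient_in_potential_fields:
  assumes \<Omega>: "open \<Omega>" and \<psi>: "\<psi> \<in> H10 \<Omega>"
  shows "weak_gradient \<Omega> \<psi> \<in> potential_fields \<Omega>"
proof -
  obtain \<phi> where \<phi>: "\<And>n::nat. \<phi> n \<in> test_functions \<Omega>"
    "(\<lambda>n. L2_norm \<Omega> (\<lambda>x. gradient (\<phi> n) x - weak_gradient \<Omega> \<psi> x)) \<longlonglongrightarrow> 0"
    using H10E[OF \<Omega> \<psi>] by blast
  show ?thesis
    unfolding potential_fields_def L2_closure_def
    using H1_weak_gradient(2)[OF H10_imp_H1[OF \<psi>]] \<phi>
    by (auto intro!: exI[of _ "\<lambda>n. gradient (\<phi> n)"])
qed

text \<open>The idea is to integrate \<open>\<phi>\<^sup>2 = \<phi>\<^sup>2 \<partial>\<^sub>i x\<^sub>i\<close> by parts.\<close>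

lemma Poincare_inequality:
  fixes \<phi> :: "real^'n \<Rightarrow> real"
  assumes \<Omega>: "open \<Omega>" and R: "\<And>x. x \<in> \<Omega> \<Longrightarrow> norm x \<le> R" "0 \<le> R" and \<phi>: "\<phi> \<in> test_functions \<Omega>"
  shows "L2_norm \<Omega> \<phi> \<le> 2 * R * L2_norm \<Omega> (gradient \<phi>)"
proof -
  \<comment> \<open>One arbitrary coordinate direction suffices.\<close>
  fix i :: 'n
  define \<eta> where "\<eta> x = x $ i * \<phi> x" for x
  have \<eta>: "\<eta> \<in> test_functions \<Omega>"
    unfolding \<eta>_def using Ck_coordinate \<phi> by (rule test_functions_mult)
  note \<phi>L = test_functions_L2[OF \<Omega> \<phi>] and \<eta>L = test_functions_L2[OF \<Omega> \<eta>]
  have "partial_deriv i (\<lambda>x::real^'n. x $ i) x = 1" for x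
    by (subst partial_deriv_eq[OF bounded_linear_imp_has_derivative[OF bounded_linear_vec_nth]]) simp
  moreover have "(\<lambda>x::real^'n. x $ i) differentiable (at x)" for x
    using Ck_coordinate[of "Suc 0" i] by simp
  ultimately have d\<eta>: "partial_deriv i \<eta> x = x $ i * partial_deriv i \<phi> x + \<phi> x" for x
    unfolding \<eta>_def using test_functions_differentiable[OF \<phi>] by (simp add: partial_deriv_mult)
  have "L2_inner \<Omega> \<phi> (partial_deriv i \<eta>) = - L2_inner \<Omega> (partial_deriv i \<phi>) \<eta>"
    using integration_by_parts[OF \<phi> \<eta> open_in_sets_lebesgue[OF \<Omega>]] by (simp add: L2_inner_real)
  moreover have "L2_inner \<Omega> \<phi> (partial_deriv i \<eta>) = L2_inner \<Omega> (partial_deriv i \<phi>) \<eta> + (L2_norm \<Omega> \<phi>)\<^sup>2"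
  proof -
    have "L2_inner \<Omega> \<phi> (partial_deriv i \<eta>) = (\<integral>x. partial_deriv i \<phi> x \<bullet> \<eta> x + \<phi> x \<bullet> \<phi> x \<partial>lebesgue_on \<Omega>)"
      unfolding L2_inner_def by (intro Bochner_Integration.integral_cong) (simp_all add: d\<eta> \<eta>_def algebra_simps)
    also have "\<dots> = L2_inner \<Omega> (partial_deriv i \<phi>) \<eta> + L2_inner \<Omega> \<phi> \<phi>"
      unfolding L2_inner_def using \<phi>L \<eta>L
      by (intro Bochner_Integration.integral_add L2_inner_integrable)
    finally show ?thesis by (simp add: L2_norm_power2)
  qed
  \<comment> \<open>The inner product with \<eta> appears in both expressions with opposite signs,
    whence the 2 in \<open>2 * R\<close>; the factor \<open>R\<close> bounds the coordinate
    \<open>x $ i\<close> on \<Omega>.\<close>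
  ultimately have "(L2_norm \<Omega> \<phi>)\<^sup>2 = - 2 * L2_inner \<Omega> (partial_deriv i \<phi>) \<eta>" by simp
  also have "\<dots> \<le> 2 * (L2_norm \<Omega> (partial_deriv i \<phi>) * L2_norm \<Omega> \<eta>)"
    using L2_Cauchy_Schwarz[OF \<phi>L(2)[of i] \<eta>L(1)] by linarith
  also have "\<dots> \<le> 2 * (L2_norm \<Omega> (gradient \<phi>) * (R * L2_norm \<Omega> \<phi>))"
  proof (intro mult_left_mono mult_mono)
    have "norm (partial_deriv i \<phi> x) \<le> 1 * norm (gradient \<phi> x)" for x
      using component_le_norm_cart[of "gradient \<phi> x" i] by (simp add: gradient_def)
    then show "L2_norm \<Omega> (partial_deriv i \<phi>) \<le> L2_norm \<Omega> (gradient \<phi>)"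
      using L2_norm_mono_AE[OF \<phi>L(2)[of i] \<phi>L(3), of 1] by simp
    show "L2_norm \<Omega> \<eta> \<le> R * L2_norm \<Omega> \<phi>"
    proof (rule L2_norm_mono_AE[OF \<eta>L(1) \<phi>L(1) R(2)])
      have "norm (\<eta> x) \<le> R * norm (\<phi> x)" if "x \<in> \<Omega>" for x
        using R(1)[OF that] component_le_norm_cart[of x i]
        by (auto simp: \<eta>_def abs_mult intro!: mult_right_mono)
      then show "AE x in lebesgue_on \<Omega>. norm (\<eta> x) \<le> R * norm (\<phi> x)"
        by (intro AE_I2) simp
    qed
  qed auto
  finally have "L2_norm \<Omega> \<phi> * L2_norm \<Omega> \<phi> \<le> L2_norm \<Omega> \<phi> * (2 * R * L2_norm \<Omega> (gradient \<phi>))"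
    by (simp add: power2_eq_square algebra_simps)
  then show ?thesis
    using R(2) by (cases "L2_norm \<Omega> \<phi> = 0") (auto simp: less_le)
qed

text \<open>The Poincare inequality is stated for test functions only. It is applied to the
  approximants, whose gradients tend to the null weak gradient, and passed to the limit.\<close>

lemma H10_eq_0_if_weak_gradient_eq_0:
  assumes \<Omega>: "open \<Omega>" "bounded \<Omega>" and \<psi>: "\<psi> \<in> H10 \<Omega>" and 0: "L2_norm \<Omega> (weak_gradient \<Omega> \<psi>) = 0"
  shows "AE x in lebesgue_on \<Omega>. \<psi> x = 0"
proof -
  obtain R where R: "0 < R" "\<And>x. x \<in> \<Omega> \<Longrightarrow> norm x \<le> R"
    using \<Omega>(2) by (auto simp: bounded_pos)
  note \<psi>L = H1_weak_gradient[OF H10_imp_H1[OF \<psi>]]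
  obtain \<phi> where \<phi>: "\<And>n::nat. \<phi> n \<in> test_functions \<Omega>"
    and lim: "(\<lambda>n. L2_norm \<Omega> (\<lambda>x. \<phi> n x - \<psi> x)) \<longlonglongrightarrow> 0"
      "(\<lambda>n. L2_norm \<Omega> (\<lambda>x. gradient (\<phi> n) x - weak_gradient \<Omega> \<psi> x)) \<longlonglongrightarrow> 0"
    using H10E[OF \<Omega>(1) \<psi>] by blast
  note \<phi>L = test_functions_L2[OF \<Omega>(1) \<phi>]
  have "L2_norm \<Omega> \<psi> \<le> 0"
  proof (rule LIMSEQ_le_const)
    show "(\<lambda>n. L2_norm \<Omega> (\<lambda>x. \<phi> n x - \<psi> x)
        + 2 * R * L2_norm \<Omega> (\<lambda>x. gradient (\<phi> n) x - weak_gradient \<Omega> \<psi> x)) \<longlonglongrightarrow> 0"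
      using tendsto_add[OF lim(1) tendsto_mult_left[OF lim(2), of "2 * R"]] by simp
    have "L2_norm \<Omega> \<psi> \<le> L2_norm \<Omega> (\<lambda>x. \<phi> n x - \<psi> x)
        + 2 * R * L2_norm \<Omega> (\<lambda>x. gradient (\<phi> n) x - weak_gradient \<Omega> \<psi> x)" for n
    proof -
      have "L2_norm \<Omega> \<psi> \<le> L2_norm \<Omega> (\<lambda>x. \<psi> x - \<phi> n x) + L2_norm \<Omega> (\<phi> n)"
        using L2_norm_triangle_diff[OF \<psi>L(1) \<phi>L(1)[of n] L2_zero] by simp
      moreover have "L2_norm \<Omega> (\<phi> n) \<le> 2 * R * L2_norm \<Omega> (gradient (\<phi> n))"
        using R by (intro Poincare_inequality \<Omega> \<phi>) auto
      moreover have "L2_norm \<Omega> (gradient (\<phi> n))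
          \<le> L2_norm \<Omega> (\<lambda>x. gradient (\<phi> n) x - weak_gradient \<Omega> \<psi> x)"
        using L2_norm_triangle_diff[OF \<phi>L(3)[of n] \<psi>L(2) L2_zero] 0 by simp
      then have "2 * R * L2_norm \<Omega> (gradient (\<phi> n))
          \<le> 2 * R * L2_norm \<Omega> (\<lambda>x. gradient (\<phi> n) x - weak_gradient \<Omega> \<psi> x)"
        using R(1) by simp
      ultimately show ?thesis
        by (simp add: L2_norm_minus_commute[of \<Omega> \<psi>])
    qed
    then show "\<exists>N. \<forall>n\<ge>N. L2_norm \<Omega> \<psi> \<le> L2_norm \<Omega> (\<lambda>x. \<phi> n x - \<psi> x)
        + 2 * R * L2_norm \<Omega> (\<lambda>x. gradient (\<phi> n) x - weak_gradient \<Omega> \<psi> x)" by blast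
  qed
  then have "L2_norm \<Omega> \<psi> = 0" using L2_norm_nonneg[of \<Omega> \<psi>] by linarith
  then show ?thesis using L2_norm_eq_0_iff[OF \<psi>L(1)] by simp
qed

section \<open>The flux norm\<close>

text \<open>Polarisation: apply the upper bound to \<open>A \<xi> + L \<xi>\<close> and positivity to \<open>A \<xi> - L \<xi>\<close>.\<close>

lemma norm_symmetric_matrix_le:
  fixes A :: "real^'n^'n"
  assumes sym: "transpose A = A" and L: "0 < L"
    and nonneg: "\<And>\<xi>. 0 \<le> \<xi> \<bullet> (A *v \<xi>)" and le: "\<And>\<xi>. \<xi> \<bullet> (A *v \<xi>) \<le> L * (norm \<xi>)\<^sup>2"
  shows "norm (A *v \<xi>) \<le> L * norm \<xi>"
proof -
  define \<eta> where "\<eta> = A *v \<xi>"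
  \<comment> \<open>With \<xi> rescaled by \<open>L\<close> the claim becomes
    \<open>norm \<eta> \<le> norm \<zeta>\<close>.\<close>
  define \<zeta> where "\<zeta> = L *\<^sub>R \<xi>"
  have A\<zeta>: "A *v \<zeta> = L *\<^sub>R \<eta>" by (simp add: \<zeta>_def \<eta>_def matrix_vector_mult_scaleR)
  \<comment> \<open>Symmetry moves \<open>A\<close> onto \<zeta>; both mixed terms of the
    polarisation identity then equal \<open>L * (norm \<eta>)\<^sup>2\<close>.\<close>
  have comm: "\<zeta> \<bullet> (A *v \<eta>) = L * (norm \<eta>)\<^sup>2"
    using dot_lmul_matrix[of \<zeta> A \<eta>] sym A\<zeta>
    by (simp add: power2_norm_eq_inner flip: transpose_matrix_vector)
  have "4 * (L * (norm \<eta>)\<^sup>2) = (\<eta> + \<zeta>) \<bullet> (A *v (\<eta> + \<zeta>)) - (\<eta> - \<zeta>) \<bullet> (A *v (\<eta> - \<zeta>))"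
    using comm by (simp add: matrix_vector_right_distrib matrix_vector_mult_diff_distrib A\<zeta>
        algebra_simps power2_norm_eq_inner)
  also have "\<dots> \<le> L * (norm (\<eta> + \<zeta>))\<^sup>2" using nonneg[of "\<eta> - \<zeta>"] le[of "\<eta> + \<zeta>"] by linarith
  also have "\<dots> \<le> L * (norm \<eta> + norm \<zeta>)\<^sup>2"
    using L by (intro mult_left_mono power_mono norm_triangle_ineq) auto
  finally have "L * (2 * norm \<eta>)\<^sup>2 \<le> L * (norm \<eta> + norm \<zeta>)\<^sup>2" by (simp add: power2_eq_square)
  then have "(2 * norm \<eta>)\<^sup>2 \<le> (norm \<eta> + norm \<zeta>)\<^sup>2" using L by simp
  then have "2 * norm \<eta> \<le> norm \<eta> + norm \<zeta>" by (rule power2_le_imp_le) simp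
  then show ?thesis using L by (simp add: \<eta>_def \<zeta>_def)
qed

text \<open>One null set serves all \<xi>, so that \<xi> may afterwards be replaced by a value
  \<open>G x\<close> depending on the point.\<close>

lemma elliptic_AE_bounds:
  assumes "elliptic_coefficients \<Omega> a lmin lmax"
  shows "AE x in lebesgue_on \<Omega>. \<forall>\<xi>. norm (a x *v \<xi>) \<le> lmax * norm \<xi> \<and> lmin * (norm \<xi>)\<^sup>2 \<le> \<xi> \<bullet> (a x *v \<xi>)"
proof -
  have l: "0 < lmin" "lmin \<le> lmax" and sym: "AE x in lebesgue_on \<Omega>. transpose (a x) = a x"
    and ell: "AE x in lebesgue_on \<Omega>. \<forall>\<xi>. lmin * (norm \<xi>)\<^sup>2 \<le> \<xi> \<bullet> (a x *v \<xi>)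
        \<and> \<xi> \<bullet> (a x *v \<xi>) \<le> lmax * (norm \<xi>)\<^sup>2"
    using assms by (auto simp: elliptic_coefficients_def)
  from sym ell show ?thesis
  proof eventually_elim
    case (elim x)
    have "0 \<le> \<xi> \<bullet> (a x *v \<xi>)" for \<xi>
      using elim(2) l(1) by (meson order_trans mult_nonneg_nonneg less_imp_le zero_le_power2)
    then show ?case using norm_symmetric_matrix_le[OF elim(1), of lmax] elim(2) l by auto
  qed
qed

lemma elliptic_mult_L2:
  assumes ell: "elliptic_coefficients \<Omega> a lmin lmax" and G: "G \<in> L2 \<Omega>"
  shows "(\<lambda>x. a x *v G x) \<in> L2 \<Omega>" "L2_norm \<Omega> (\<lambda>x. a x *v G x) \<le> lmax * L2_norm \<Omega> G"
proof -
  have am: "(\<lambda>x. a x $ i $ j) \<in> borel_measurable (lebesgue_on \<Omega>)" for i j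
    using ell by (simp add: elliptic_coefficients_def Linf_def)
  have "(\<lambda>x. (a x *v G x) $ i) \<in> borel_measurable (lebesgue_on \<Omega>)" for i
    unfolding matrix_vector_mult_def vec_lambda_beta
    by (intro borel_measurable_sum borel_measurable_times am L2_measurable[OF L2_component[OF G]])
  then have m: "(\<lambda>x. a x *v G x) \<in> borel_measurable (lebesgue_on \<Omega>)"
    by (auto simp: borel_measurable_euclidean_space[of "\<lambda>x. a x *v G x"] Basis_vec_def inner_axis)
  have b: "AE x in lebesgue_on \<Omega>. norm (a x *v G x) \<le> lmax * norm (G x)"
    using elliptic_AE_bounds[OF ell] by eventually_elim auto
  show L: "(\<lambda>x. a x *v G x) \<in> L2 \<Omega>" using m G b by (rule L2_dominated)
  show "L2_norm \<Omega> (\<lambda>x. a x *v G x) \<le> lmax * L2_norm \<Omega> G"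
    by (rule L2_norm_mono_AE[OF L G _ b]) (use ell in \<open>auto simp: elliptic_coefficients_def\<close>)
qed

lemma elliptic_L2_inner_ge:
  assumes ell: "elliptic_coefficients \<Omega> a lmin lmax" and G: "G \<in> L2 \<Omega>"
  shows "lmin * (L2_norm \<Omega> G)\<^sup>2 \<le> L2_inner \<Omega> (\<lambda>x. a x *v G x) G"
proof -
  have "(\<integral>x. lmin * (norm (G x))\<^sup>2 \<partial>lebesgue_on \<Omega>) \<le> (\<integral>x. (a x *v G x) \<bullet> G x \<partial>lebesgue_on \<Omega>)"
  proof (rule integral_mono_AE)
    show "AE x in lebesgue_on \<Omega>. lmin * (norm (G x))\<^sup>2 \<le> (a x *v G x) \<bullet> G x"
      using elliptic_AE_bounds[OF ell] by eventually_elim (simp add: inner_commute)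
  qed (use L2_integrable[OF G] L2_inner_integrable[OF elliptic_mult_L2(1)[OF ell G] G] in auto)
  then show ?thesis by (simp add: L2_norm_def L2_inner_def)
qed

section \<open>Independence of representatives, norm axioms and the two bounds\<close>

lemma pot_is_projection:
  assumes "open \<Omega>" "k \<in> L2 \<Omega>"
  shows "is_L2_projection \<Omega> (potential_fields \<Omega>) k (pot \<Omega> k)"
  unfolding pot_def
  by (rule someI_ex[OF L2_projection_exists[OF closed_L2_subspace_potential_fields]]) (use assms in auto)

text \<open>Removes both choices from \<open>flux_norm\<close>. The chosen gradient equals
  \<open>G\<close> almost everywhere, so \<open>p\<close> is also a projection of the chosen flux,
  and all projections of one field have the same norm.\<close>

lemma flux_norm_eqI:
  assumes \<Omega>: "open \<Omega>" and ell: "elliptic_coefficients \<Omega> a lmin lmax"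
    and G: "G \<in> L2 \<Omega>" "is_weak_gradient \<Omega> \<psi> G"
    and p: "is_L2_projection \<Omega> (potential_fields \<Omega>) (\<lambda>x. a x *v G x) p"
  shows "flux_norm \<Omega> a \<psi> = L2_norm \<Omega> p"
proof -
  let ?k = "\<lambda>x. a x *v weak_gradient \<Omega> \<psi> x"
  have V: "closed_L2_subspace \<Omega> (potential_fields \<Omega>)"
    using \<Omega> by (rule closed_L2_subspace_potential_fields)
  have k: "?k \<in> L2 \<Omega>" using weak_gradient_someI(1)[OF G] by (rule elliptic_mult_L2(1)[OF ell])
  have "AE x in lebesgue_on \<Omega>. a x *v G x = ?k x"
    using weak_gradient_AE_eq[OF \<Omega> G] by eventually_elim simp
  then have "is_L2_projection \<Omega> (potential_fields \<Omega>) ?k p"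
    by (rule is_L2_projection_cong_AE[OF V elliptic_mult_L2(1)[OF ell G(1)] k _ p])
  then show ?thesis
    unfolding flux_norm_def
    by (rule L2_norm_projection_unique[OF V k pot_is_projection[OF \<Omega> k]])
qed

lemma flux_norm_cmult:
  assumes \<Omega>: "open \<Omega>" and ell: "elliptic_coefficients \<Omega> a lmin lmax" and f: "f \<in> H1 \<Omega>"
  shows "flux_norm \<Omega> a (\<lambda>x. c * f x) = \<bar>c\<bar> * flux_norm \<Omega> a f"
proof -
  note F = H1_weak_gradient[OF f]
  let ?k = "\<lambda>x. a x *v weak_gradient \<Omega> f x"
  note k = elliptic_mult_L2(1)[OF ell F(2)]
  have "flux_norm \<Omega> a (\<lambda>x. c * f x) = L2_norm \<Omega> (\<lambda>x. c *\<^sub>R pot \<Omega> ?k x)"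
  proof (rule flux_norm_eqI[OF \<Omega> ell L2_scale[OF F(2)] is_weak_gradient_cmult[OF F(3)]])
    show "is_L2_projection \<Omega> (potential_fields \<Omega>)
        (\<lambda>x. a x *v c *\<^sub>R weak_gradient \<Omega> f x) (\<lambda>x. c *\<^sub>R pot \<Omega> ?k x)"
      using is_L2_projection_scale[OF closed_L2_subspace_potential_fields[OF \<Omega>] pot_is_projection[OF \<Omega> k]]
      by (simp add: matrix_vector_mult_scaleR)
  qed
  then show ?thesis by (simp add: L2_norm_scale flux_norm_def)
qed

lemma flux_norm_triangle:
  assumes \<Omega>: "open \<Omega>" and ell: "elliptic_coefficients \<Omega> a lmin lmax"
    and f: "f \<in> H1 \<Omega>" and g: "g \<in> H1 \<Omega>"
  shows "flux_norm \<Omega> a (\<lambda>x. f x + g x) \<le> flux_norm \<Omega> a f + flux_norm \<Omega> a g"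
proof -
  note F = H1_weak_gradient[OF f] and G = H1_weak_gradient[OF g]
  note V = closed_L2_subspace_potential_fields[OF \<Omega>]
  define k where "k x = a x *v weak_gradient \<Omega> f x" for x
  define l where "l x = a x *v weak_gradient \<Omega> g x" for x
  have k: "k \<in> L2 \<Omega>" and l: "l \<in> L2 \<Omega>"
    using elliptic_mult_L2(1)[OF ell] F(2) G(2) by (auto simp: k_def[abs_def] l_def[abs_def])
  note pk = pot_is_projection[OF \<Omega> k] and pl = pot_is_projection[OF \<Omega> l]
  have "flux_norm \<Omega> a (\<lambda>x. f x + g x) = L2_norm \<Omega> (\<lambda>x. pot \<Omega> k x + pot \<Omega> l x)"
  proof (rule flux_norm_eqI[OF \<Omega> ell])
    show "is_L2_projection \<Omega> (potential_fields \<Omega>)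
        (\<lambda>x. a x *v (weak_gradient \<Omega> f x + weak_gradient \<Omega> g x)) (\<lambda>x. pot \<Omega> k x + pot \<Omega> l x)"
      using is_L2_projection_add[OF V k l pk pl]
      by (simp add: k_def l_def matrix_vector_right_distrib)
  qed (use F G \<Omega> in \<open>auto intro: L2_add is_weak_gradient_add\<close>)
  also have "\<dots> \<le> L2_norm \<Omega> (pot \<Omega> k) + L2_norm \<Omega> (pot \<Omega> l)"
    using pk pl closed_L2_subspaceD(1)[OF V] by (intro L2_norm_triangle) (auto simp: is_L2_projection_def)
  finally show ?thesis by (simp add: flux_norm_def k_def[abs_def] l_def[abs_def])
qed

lemma flux_norm_cong_AE:
  assumes "open \<Omega>" "f \<in> L2 \<Omega>" "g \<in> L2 \<Omega>" "AE x in lebesgue_on \<Omega>. f x = g x"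
  shows "flux_norm \<Omega> a f = flux_norm \<Omega> a g"
  by (simp add: flux_norm_def weak_gradient_def is_weak_gradient_cong_AE[OF assms])

lemma flux_norm_nonneg: "0 \<le> flux_norm \<Omega> a \<psi>"
  by (simp add: flux_norm_def)

lemma flux_norm_bounds:
  assumes \<Omega>: "open \<Omega>" and ell: "elliptic_coefficients \<Omega> a lmin lmax" and \<psi>: "\<psi> \<in> H10 \<Omega>"
  shows "lmin * L2_norm \<Omega> (weak_gradient \<Omega> \<psi>) \<le> flux_norm \<Omega> a \<psi>"
    and "flux_norm \<Omega> a \<psi> \<le> lmax * L2_norm \<Omega> (weak_gradient \<Omega> \<psi>)"
proof -
  define G where "G = weak_gradient \<Omega> \<psi>"
  define k where "k x = a x *v G x" for x
  define p where "p = pot \<Omega> k"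
  note V = closed_L2_subspace_potential_fields[OF \<Omega>]
  have G: "G \<in> L2 \<Omega>" unfolding G_def using \<psi> by (intro H1_weak_gradient H10_imp_H1)
  have k: "k \<in> L2 \<Omega>" using elliptic_mult_L2(1)[OF ell G] by (simp add: k_def[abs_def])
  have proj: "p \<in> potential_fields \<Omega>"
    and orth: "\<And>v. v \<in> potential_fields \<Omega> \<Longrightarrow> L2_inner \<Omega> (\<lambda>x. k x - p x) v = 0"
    using pot_is_projection[OF \<Omega> k] by (auto simp: is_L2_projection_def p_def)
  have p: "p \<in> L2 \<Omega>" using closed_L2_subspaceD(1)[OF V proj] .
  have flux: "flux_norm \<Omega> a \<psi> = L2_norm \<Omega> p"
    by (simp add: flux_norm_def p_def k_def[abs_def] G_def)
  have inner_eq: "L2_inner \<Omega> k v = L2_inner \<Omega> p v" if "v \<in> potential_fields \<Omega>" for v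
    using orth[OF that] L2_inner_diff_left[OF k p closed_L2_subspaceD(1)[OF V that]] by simp
  \<comment> \<open>Upper bound: orthogonality is tested with \<open>p\<close> itself, so projecting
    does not increase the norm.\<close>
  have "L2_norm \<Omega> p * L2_norm \<Omega> p = L2_inner \<Omega> k p"
    using inner_eq[OF proj] L2_norm_power2[of \<Omega> p] by (simp add: power2_eq_square)
  also have "\<dots> \<le> L2_norm \<Omega> k * L2_norm \<Omega> p" using L2_Cauchy_Schwarz[OF k p] by linarith
  finally have "L2_norm \<Omega> p \<le> L2_norm \<Omega> k"
    by (cases "L2_norm \<Omega> p = 0") (auto simp: less_le)
  also have "\<dots> \<le> lmax * L2_norm \<Omega> G"
    using elliptic_mult_L2(2)[OF ell G] by (simp add: k_def[abs_def])
  finally show "flux_norm \<Omega> a \<psi> \<le> lmax * L2_norm \<Omega> (weak_gradient \<Omega> \<psi>)"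
    by (simp add: flux G_def)
  have GV: "G \<in> potential_fields \<Omega>"
    unfolding G_def using \<Omega> \<psi> by (rule weak_gradient_in_potential_fields)
  \<comment> \<open>Lower bound: orthogonality is tested with \<open>G\<close>, which replaces
    \<open>k\<close> by \<open>p\<close> in the ellipticity estimate.\<close>
  have "lmin * (L2_norm \<Omega> G)\<^sup>2 \<le> L2_inner \<Omega> p G"
    using elliptic_L2_inner_ge[OF ell G] inner_eq[OF GV] by (simp add: k_def[abs_def])
  also have "\<dots> \<le> L2_norm \<Omega> p * L2_norm \<Omega> G" using L2_Cauchy_Schwarz[OF p G] by linarith
  finally have "lmin * L2_norm \<Omega> G * L2_norm \<Omega> G \<le> L2_norm \<Omega> p * L2_norm \<Omega> G"
    by (simp add: power2_eq_square algebra_simps)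
  then have "lmin * L2_norm \<Omega> G \<le> L2_norm \<Omega> p"
    by (cases "L2_norm \<Omega> G = 0") (auto simp: less_le)
  then show "lmin * L2_norm \<Omega> (weak_gradient \<Omega> \<psi>) \<le> flux_norm \<Omega> a \<psi>"
    by (simp add: flux G_def)
qed

lemma flux_norm_eq_0_iff:
  assumes \<Omega>: "open \<Omega>" "bounded \<Omega>" and ell: "elliptic_coefficients \<Omega> a lmin lmax"
    and \<psi>: "\<psi> \<in> H10 \<Omega>"
  shows "flux_norm \<Omega> a \<psi> = 0 \<longleftrightarrow> (AE x in lebesgue_on \<Omega>. \<psi> x = 0)"
proof
  assume "flux_norm \<Omega> a \<psi> = 0"
  moreover have "0 < lmin" using ell by (simp add: elliptic_coefficients_def)
  ultimately have "L2_norm \<Omega> (weak_gradient \<Omega> \<psi>) \<le> 0"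
    using flux_norm_bounds(1)[OF \<Omega>(1) ell \<psi>] by (simp add: mult_le_0_iff)
  then have "L2_norm \<Omega> (weak_gradient \<Omega> \<psi>) = 0"
    using L2_norm_nonneg[of \<Omega> "weak_gradient \<Omega> \<psi>"] by linarith
  then show "AE x in lebesgue_on \<Omega>. \<psi> x = 0"
    by (rule H10_eq_0_if_weak_gradient_eq_0[OF \<Omega> \<psi>])
next
  assume 0: "AE x in lebesgue_on \<Omega>. \<psi> x = 0"
  have "flux_norm \<Omega> a \<psi> = flux_norm \<Omega> a (\<lambda>x. 0)"
    by (rule flux_norm_cong_AE[OF \<Omega>(1) _ L2_zero 0])
      (use H1_weak_gradient(1)[OF H10_imp_H1[OF \<psi>]] in simp)
  \<comment> \<open>The zero function is 0 times itself, so homogeneity gives 0 whatever weak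
    gradient is chosen for it.\<close>
  also have "\<dots> = 0"
    using flux_norm_cmult[OF \<Omega>(1) ell H10_imp_H1[OF H10_zero[OF \<Omega>(1)]], of 0] by simp
  finally show "flux_norm \<Omega> a \<psi> = 0" .
qed

theorem proposition2p1:
  fixes \<Omega> :: "(real^'d) set"
    and a :: "real^'d \<Rightarrow> real^'d^'d"
    and lmin lmax :: real
  assumes "CARD('d) \<ge> 2"
    and "bounded_C2_domain \<Omega>"
    and "elliptic_coefficients \<Omega> a lmin lmax"
  shows "is_norm_on_AE (lebesgue_on \<Omega>) (H10 \<Omega>) (flux_norm \<Omega> a) \<and>
    (\<forall>\<psi> \<in> H10 \<Omega>.
       lmin * L2_norm \<Omega> (weak_gradient \<Omega> \<psi>) \<le> flux_norm \<Omega> a \<psi> \<and>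
       flux_norm \<Omega> a \<psi> \<le> lmax * L2_norm \<Omega> (weak_gradient \<Omega> \<psi>))"
proof -
  have \<Omega>: "open \<Omega>" "bounded \<Omega>" using assms(2) by (auto simp: bounded_C2_domain_def)
  note ell = assms(3)
  have "is_norm_on_AE (lebesgue_on \<Omega>) (H10 \<Omega>) (flux_norm \<Omega> a)"
    unfolding is_norm_on_AE_def
  proof (intro conjI ballI allI impI)
    fix f g assume "f \<in> H10 \<Omega>" "g \<in> H10 \<Omega>" "AE x in lebesgue_on \<Omega>. f x = g x"
    then show "flux_norm \<Omega> a f = flux_norm \<Omega> a g"
      using H1_weak_gradient(1)[OF H10_imp_H1] \<Omega>(1) by (intro flux_norm_cong_AE) auto
  qed (use \<Omega> in \<open>simp_all add: H10_zero H10_add H10_cmult flux_norm_eq_0_iff[OF _ _ ell]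
      flux_norm_cmult[OF _ ell] flux_norm_triangle[OF _ ell] H10_imp_H1 flux_norm_nonneg\<close>)
  then show ?thesis using flux_norm_bounds[OF \<Omega>(1) ell] by blast
qed

end
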